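(* Let $R$ be a commutative unital ring, let $C$ be an $R$-coalgebra with counit $\epsilon$ and let $A$ be an $R$-algebra with unit $\eta$. Let $\{F_iC\}_{i=0}^{\infty}$ be a QT-sequence on $C$ such that $\mathrm{Ext}^1_R(C/F_0C,A)=0$. Then for any element $f\in\mathrm{Hom}(C,A)$: $f$ is $\star$-invertible in $\mathrm{Hom}(C,A)$ if and only if the restriction $f|_{F_0C}$ is $\star$-invertible in $\mathrm{Hom}(F_0C,A)$.
   Context: All tensor products and $\mathrm{Hom}$'s are over $R$; algebras are associative and unital, coalgebras coassociative and counital. For submodules $M,N\subset C$ of a coalgebra, $M\boxtimes N\subset C\otimes C$ denotes the submodule of finite sums of $x\otimes y$ with $x\in M$, $y\in N$ (the image of $M\otimes N$ in $C\otimes C$). A submodule $S\subset C$ is called a subcoalgebra if $\Delta(S)\subset S\boxtimes S$. A QT-filtration of $C$ is an increasing filtration of $C$ by $R$-submodules $F_pC$, $p\ge 0$, such that (1) $F_0C$ is a subcoalgebra, and (2) $\Delta(F_pC)\subset F_{p-1}C\boxtimes C+C\boxtimes F_{p-1}C$ for $p\geq 1$. It is a QT-sequence if it is exhaustive, i.e. $C=\bigcup_{p\ge0}F_pC$. The convolution algebra is $\mathrm{Hom}(C,A)$ with $(f\star g)(x)=\sum f(x_{(1)})g(x_{(2)})$ (Sweedler notation) and unit $\eta\circ\epsilon$. For a subcoalgebra $S\subset C$, $\mathrm{Hom}(S,A)$ is regarded as the convolution algebra with $(f\star g)(s)=\sum f(s_{(1)})g(s_{(2)})$, where $\Delta(s)=\sum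 s_{(1)}\otimes s_{(2)}$ is written with $s_{(1)},s_{(2)}\in S$, and with unit $\eta\circ\epsilon|_S$. $\star$-invertible means having a two-sided inverse for $\star$. *)

theory Defs
  imports "HOL-Algebra.Module" "HOL-Algebra.AbelCoset"
begin

section \<open>Modules\<close>

text \<open>Homomorphisms are extensional, so that two of them are equal iff they agree on the carrier.\<close>

definition mod_hom ::
    "('r, 'k) ring_scheme \<Rightarrow> ('r, 'm, 'i) module_scheme \<Rightarrow> ('r, 'n, 'j) module_scheme \<Rightarrow> ('m \<Rightarrow> 'n) set"
  where "mod_hom R M N =
    {h \<in> carrier M \<rightarrow>\<^sub>E carrier N.
       (\<forall>x\<in>carrier M. \<forall>y\<in>carrier M. h (x \<oplus>\<^bsub>M\<^esub> y) = h x \<oplus>\<^bsub>N\<^esub> h y) \<and>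
       (\<forall>r\<in>carrier R. \<forall>x\<in>carrier M. h (r \<odot>\<^bsub>M\<^esub> x) = r \<odot>\<^bsub>N\<^esub> h x)}"

text \<open>
  The record type of modules extends that of rings; the fields \<^const>\<open>mult\<close> and \<^const>\<open>one\<close>
  play no role in a module and are left unspecified below.
\<close>

definition hom_module ::
    "('r, 'k) ring_scheme \<Rightarrow> ('r, 'm, 'i) module_scheme \<Rightarrow> ('r, 'n, 'j) module_scheme
      \<Rightarrow> ('r, 'm \<Rightarrow> 'n) module"
  where "hom_module R M N =
    \<lparr>carrier = mod_hom R M N, mult = undefined, one = undefined,
     zero = (\<lambda>x\<in>carrier M. \<zero>\<^bsub>N\<^esub>),
     add = (\<lambda>g h. \<lambda>x\<in>carrier M. g x \<oplus>\<^bsub>N\<^esub> h x),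
     smult = (\<lambda>r h. \<lambda>x\<in>carrier M. r \<odot>\<^bsub>N\<^esub> h x)\<rparr>"

definition quot_module :: "('r, 'm, 'i) module_scheme \<Rightarrow> 'm set \<Rightarrow> ('r, 'm set) module"
  where "quot_module M N =
    \<lparr>carrier = a_rcosets\<^bsub>M\<^esub> N, mult = undefined, one = undefined,
     zero = N, add = set_add M,
     smult = (\<lambda>r X. \<Union>x\<in>X. N +>\<^bsub>M\<^esub> (r \<odot>\<^bsub>M\<^esub> x))\<rparr>"

definition span_module :: "('r, 'k) ring_scheme \<Rightarrow> ('r, 'm, 'i) module_scheme \<Rightarrow> 'm set \<Rightarrow> 'm set"
  where "span_module R M X = \<Inter>{N. submodule N R M \<and> X \<subseteq> N}"

definition free_module :: "('r, 'k) ring_scheme \<Rightarrow> 'x set \<Rightarrow> ('r, 'x \<Rightarrow> 'r) module"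
  where "free_module R X =
    \<lparr>carrier = {v. range v \<subseteq> carrier R \<and> finite {x. v x \<noteq> \<zero>\<^bsub>R\<^esub>} \<and> {x. v x \<noteq> \<zero>\<^bsub>R\<^esub>} \<subseteq> X},
     mult = undefined, one = undefined,
     zero = (\<lambda>x. \<zero>\<^bsub>R\<^esub>), add = (\<lambda>v w x. v x \<oplus>\<^bsub>R\<^esub> w x), smult = (\<lambda>r v x. r \<otimes>\<^bsub>R\<^esub> v x)\<rparr>"

definition basis_elt :: "('r, 'k) ring_scheme \<Rightarrow> 'x \<Rightarrow> 'x \<Rightarrow> 'r"
  where "basis_elt R x = (\<lambda>y. if y = x then \<one>\<^bsub>R\<^esub> else \<zero>\<^bsub>R\<^esub>)"

text \<open>The linear extension to a free module of a map \<open>\<phi>\<close> given on the basis.\<close>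

definition free_lift ::
    "('r, 'k) ring_scheme \<Rightarrow> ('r, 'm, 'i) module_scheme \<Rightarrow> ('x \<Rightarrow> 'm) \<Rightarrow> ('x \<Rightarrow> 'r) \<Rightarrow> 'm"
  where "free_lift R M \<phi> v = (\<Oplus>\<^bsub>M\<^esub>x\<in>{x. v x \<noteq> \<zero>\<^bsub>R\<^esub>}. v x \<odot>\<^bsub>M\<^esub> \<phi> x)"


section \<open>Ext\<close>

text \<open>
  A module \<open>M\<close> has the canonical presentation by the free module on its carrier. Its kernel is the
  syzygy of \<open>M\<close>, and iterating gives the canonical free resolution
  \<open>\<dots> \<rightarrow> P\<^sub>2 \<rightarrow> P\<^sub>1 \<rightarrow> P\<^sub>0 \<rightarrow> M\<close>, where \<open>P\<^sub>n\<close> is free on the carrier of the \<open>n\<close>-th syzygy and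
  \<open>P\<^sub>n \<rightarrow> P\<^sub>n\<^sub>-\<^sub>1\<close> is the linear extension of the inclusion of that syzygy into \<open>P\<^sub>n\<^sub>-\<^sub>1\<close>.
\<close>

definition free_cover :: "('r, 'k) ring_scheme \<Rightarrow> ('r, 'm, 'i) module_scheme \<Rightarrow> ('r, 'm \<Rightarrow> 'r) module"
  where "free_cover R M = free_module R (carrier M)"

definition syzygy :: "('r, 'k) ring_scheme \<Rightarrow> ('r, 'm, 'i) module_scheme \<Rightarrow> ('r, 'm \<Rightarrow> 'r) module"
  where "syzygy R M = (free_cover R M)
    \<lparr>carrier := {v \<in> carrier (free_cover R M). free_lift R M id v = \<zero>\<^bsub>M\<^esub>}\<rparr>"

abbreviation res0 :: "('r, 'k) ring_scheme \<Rightarrow> ('r, 'm, 'i) module_scheme \<Rightarrow> ('r, 'm \<Rightarrow> 'r) module"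
  where "res0 R M \<equiv> free_cover R M"

abbreviation res1 :: "('r, 'k) ring_scheme \<Rightarrow> ('r, 'm, 'i) module_scheme \<Rightarrow> ('r, ('m \<Rightarrow> 'r) \<Rightarrow> 'r) module"
  where "res1 R M \<equiv> free_cover R (syzygy R M)"

abbreviation res2 ::
    "('r, 'k) ring_scheme \<Rightarrow> ('r, 'm, 'i) module_scheme \<Rightarrow> ('r, (('m \<Rightarrow> 'r) \<Rightarrow> 'r) \<Rightarrow> 'r) module"
  where "res2 R M \<equiv> free_cover R (syzygy R (syzygy R M))"

definition res_d1 :: "('r, 'k) ring_scheme \<Rightarrow> ('r, 'm, 'i) module_scheme \<Rightarrow> (('m \<Rightarrow> 'r) \<Rightarrow> 'r) \<Rightarrow> 'm \<Rightarrow> 'r"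
  where "res_d1 R M = free_lift R (res0 R M) id"

definition res_d2 ::
    "('r, 'k) ring_scheme \<Rightarrow> ('r, 'm, 'i) module_scheme \<Rightarrow> ((('m \<Rightarrow> 'r) \<Rightarrow> 'r) \<Rightarrow> 'r) \<Rightarrow> ('m \<Rightarrow> 'r) \<Rightarrow> 'r"
  where "res_d2 R M = free_lift R (res1 R M) id"

definition ext1_cocycles ::
    "('r, 'k) ring_scheme \<Rightarrow> ('r, 'm, 'i) module_scheme \<Rightarrow> ('r, 'n, 'j) module_scheme
      \<Rightarrow> ((('m \<Rightarrow> 'r) \<Rightarrow> 'r) \<Rightarrow> 'n) set"
  where "ext1_cocycles R M N =
    {\<phi> \<in> mod_hom R (res1 R M) N. \<forall>w\<in>carrier (res2 R M). \<phi> (res_d2 R M w) = \<zero>\<^bsub>N\<^esub>}"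

definition ext1_coboundaries ::
    "('r, 'k) ring_scheme \<Rightarrow> ('r, 'm, 'i) module_scheme \<Rightarrow> ('r, 'n, 'j) module_scheme
      \<Rightarrow> ((('m \<Rightarrow> 'r) \<Rightarrow> 'r) \<Rightarrow> 'n) set"
  where "ext1_coboundaries R M N =
    (\<lambda>\<psi>. \<lambda>v\<in>carrier (res1 R M). \<psi> (res_d1 R M v)) ` mod_hom R (res0 R M) N"

definition Ext1 ::
    "('r, 'k) ring_scheme \<Rightarrow> ('r, 'm, 'i) module_scheme \<Rightarrow> ('r, 'n, 'j) module_scheme
      \<Rightarrow> ('r, ((('m \<Rightarrow> 'r) \<Rightarrow> 'r) \<Rightarrow> 'n) set) module"
  where "Ext1 R M N =
    quot_module ((hom_module R (res1 R M) N)\<lparr>carrier := ext1_cocycles R M N\<rparr>) (ext1_coboundaries R M N)"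


section \<open>Tensor products\<close>

definition tensor_rels ::
    "('r, 'k) ring_scheme \<Rightarrow> ('r, 'm, 'i) module_scheme \<Rightarrow> ('r, 'n, 'j) module_scheme
      \<Rightarrow> ('m \<times> 'n \<Rightarrow> 'r) set"
  where "tensor_rels R M N =
    (let F = free_module R (carrier M \<times> carrier N); e = (\<lambda>x y. basis_elt R (x, y)) in
      {e (x \<oplus>\<^bsub>M\<^esub> x') y \<ominus>\<^bsub>F\<^esub> (e x y \<oplus>\<^bsub>F\<^esub> e x' y) | x x' y.
         x \<in> carrier M \<and> x' \<in> carrier M \<and> y \<in> carrier N} \<union>
      {e x (y \<oplus>\<^bsub>N\<^esub> y') \<ominus>\<^bsub>F\<^esub> (e x y \<oplus>\<^bsub>F\<^esub> e x y') | x y y'.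
         x \<in> carrier M \<and> y \<in> carrier N \<and> y' \<in> carrier N} \<union>
      {e (r \<odot>\<^bsub>M\<^esub> x) y \<ominus>\<^bsub>F\<^esub> (r \<odot>\<^bsub>F\<^esub> e x y) | r x y.
         r \<in> carrier R \<and> x \<in> carrier M \<and> y \<in> carrier N} \<union>
      {e x (r \<odot>\<^bsub>N\<^esub> y) \<ominus>\<^bsub>F\<^esub> (r \<odot>\<^bsub>F\<^esub> e x y) | r x y.
         r \<in> carrier R \<and> x \<in> carrier M \<and> y \<in> carrier N})"

definition tensor_ker ::
    "('r, 'k) ring_scheme \<Rightarrow> ('r, 'm, 'i) module_scheme \<Rightarrow> ('r, 'n, 'j) module_scheme
      \<Rightarrow> ('m \<times> 'n \<Rightarrow> 'r) set"
  where "tensor_ker R M N =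
    span_module R (free_module R (carrier M \<times> carrier N)) (tensor_rels R M N)"

definition tensor_module ::
    "('r, 'k) ring_scheme \<Rightarrow> ('r, 'm, 'i) module_scheme \<Rightarrow> ('r, 'n, 'j) module_scheme
      \<Rightarrow> ('r, ('m \<times> 'n \<Rightarrow> 'r) set) module"
  where "tensor_module R M N =
    quot_module (free_module R (carrier M \<times> carrier N)) (tensor_ker R M N)"

definition tensor ::
    "('r, 'k) ring_scheme \<Rightarrow> ('r, 'm, 'i) module_scheme \<Rightarrow> ('r, 'n, 'j) module_scheme
      \<Rightarrow> 'm \<Rightarrow> 'n \<Rightarrow> ('m \<times> 'n \<Rightarrow> 'r) set"
  where "tensor R M N x y =
    tensor_ker R M N +>\<^bsub>free_module R (carrier M \<times> carrier N)\<^esub> basis_elt R (x, y)"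

text \<open>The linear map \<open>x \<otimes> y \<mapsto> \<beta> x y\<close> on a tensor product induced by a bilinear map \<open>\<beta>\<close> into \<open>P\<close>.\<close>

definition tensor_lift ::
    "('r, 'k) ring_scheme \<Rightarrow> ('r, 'p, 'i) module_scheme \<Rightarrow> ('m \<Rightarrow> 'n \<Rightarrow> 'p)
      \<Rightarrow> ('m \<times> 'n \<Rightarrow> 'r) set \<Rightarrow> 'p"
  where "tensor_lift R P \<beta> t = the_elem (free_lift R P (\<lambda>(x, y). \<beta> x y) ` t)"

definition pair_sum :: "('p, 'k) ring_scheme \<Rightarrow> ('m \<Rightarrow> 'n \<Rightarrow> 'p) \<Rightarrow> ('m \<times> 'n) list \<Rightarrow> 'p"
  where "pair_sum P \<beta> xs = foldr (\<lambda>(x, y) s. \<beta> x y \<oplus>\<^bsub>P\<^esub> s) xs \<zero>\<^bsub>P\<^esub>"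

text \<open>\<open>M \<boxtimes> N\<close>, for submodules \<open>M\<close> and \<open>N\<close> of \<open>C\<close>, is a submodule of \<open>C \<otimes> C\<close>.\<close>

definition boxtimes ::
    "('r, 'k) ring_scheme \<Rightarrow> ('r, 'c, 'i) module_scheme \<Rightarrow> 'c set \<Rightarrow> 'c set \<Rightarrow> ('c \<times> 'c \<Rightarrow> 'r) set set"
  where "boxtimes R C M N =
    {pair_sum (tensor_module R C C) (tensor R C C) xs | xs. set xs \<subseteq> M \<times> N}"


section \<open>Coalgebras and algebras\<close>

text \<open>
  In \<open>coassoc\<close> the outer lift on the left-hand side is the associator
  \<open>(u \<otimes> v) \<otimes> z \<mapsto> u \<otimes> (v \<otimes> z)\<close>; in the counit laws \<open>R \<otimes> C\<close> and \<open>C \<otimes> R\<close> are identified with \<open>C\<close>.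
\<close>

locale coalgebra = module R C
  for R :: "('r, 'k) ring_scheme" (structure) and C :: "('r, 'c, 'i) module_scheme" (structure)
    and \<Delta> :: "'c \<Rightarrow> ('c \<times> 'c \<Rightarrow> 'r) set" and \<epsilon> :: "'c \<Rightarrow> 'r" +
  assumes comult_hom: "restrict \<Delta> (carrier C) \<in> mod_hom R C (tensor_module R C C)"
    and counit_closed: "x \<in> carrier C \<Longrightarrow> \<epsilon> x \<in> carrier R"
    and counit_add: "\<lbrakk>x \<in> carrier C; y \<in> carrier C\<rbrakk> \<Longrightarrow> \<epsilon> (x \<oplus>\<^bsub>C\<^esub> y) = \<epsilon> x \<oplus>\<^bsub>R\<^esub> \<epsilon> y"
    and counit_smult: "\<lbrakk>r \<in> carrier R; x \<in> carrier C\<rbrakk> \<Longrightarrow> \<epsilon> (r \<odot>\<^bsub>C\<^esub> x) = r \<otimes>\<^bsub>R\<^esub> \<epsilon> x"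
    and coassoc: "x \<in> carrier C \<Longrightarrow>
      (let CC = tensor_module R C C; C_CC = tensor_module R C CC; CC_C = tensor_module R CC C in
        tensor_lift R C_CC
          (\<lambda>t z. tensor_lift R C_CC (\<lambda>u v. tensor R C CC u (tensor R C C v z)) t)
          (tensor_lift R CC_C (\<lambda>u v. tensor R CC C (\<Delta> u) v) (\<Delta> x))
        = tensor_lift R C_CC (\<lambda>u v. tensor R C CC u (\<Delta> v)) (\<Delta> x))"
    and counit_l: "x \<in> carrier C \<Longrightarrow> tensor_lift R C (\<lambda>u v. \<epsilon> u \<odot>\<^bsub>C\<^esub> v) (\<Delta> x) = x"
    and counit_r: "x \<in> carrier C \<Longrightarrow> tensor_lift R C (\<lambda>u v. \<epsilon> v \<odot>\<^bsub>C\<^esub> u) (\<Delta> x) = x"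

text \<open>The library's locale \<^locale>\<open>algebra\<close> is restricted to commutative algebras.\<close>

locale assoc_algebra = module R A + ring A
  for R :: "('r, 'k) ring_scheme" (structure) and A :: "('r, 'a, 'i) module_scheme" (structure) +
  assumes smult_mult_l: "\<lbrakk>r \<in> carrier R; a \<in> carrier A; b \<in> carrier A\<rbrakk> \<Longrightarrow>
      (r \<odot>\<^bsub>A\<^esub> a) \<otimes>\<^bsub>A\<^esub> b = r \<odot>\<^bsub>A\<^esub> (a \<otimes>\<^bsub>A\<^esub> b)"
    and smult_mult_r: "\<lbrakk>r \<in> carrier R; a \<in> carrier A; b \<in> carrier A\<rbrakk> \<Longrightarrow>
      a \<otimes>\<^bsub>A\<^esub> (r \<odot>\<^bsub>A\<^esub> b) = r \<odot>\<^bsub>A\<^esub> (a \<otimes>\<^bsub>A\<^esub> b)"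

definition unit_map :: "('r, 'a, 'i) module_scheme \<Rightarrow> 'r \<Rightarrow> 'a"
  where "unit_map A r = r \<odot>\<^bsub>A\<^esub> \<one>\<^bsub>A\<^esub>"

definition subcoalgebra ::
    "('r, 'k) ring_scheme \<Rightarrow> ('r, 'c, 'i) module_scheme \<Rightarrow> ('c \<Rightarrow> ('c \<times> 'c \<Rightarrow> 'r) set) \<Rightarrow> 'c set \<Rightarrow> bool"
  where "subcoalgebra R C \<Delta> S \<longleftrightarrow> submodule S R C \<and> \<Delta> ` S \<subseteq> boxtimes R C S S"

definition QT_filtration ::
    "('r, 'k) ring_scheme \<Rightarrow> ('r, 'c, 'i) module_scheme \<Rightarrow> ('c \<Rightarrow> ('c \<times> 'c \<Rightarrow> 'r) set)
      \<Rightarrow> (nat \<Rightarrow> 'c set) \<Rightarrow> bool"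
  where "QT_filtration R C \<Delta> F \<longleftrightarrow>
    (\<forall>p. submodule (F p) R C) \<and> (\<forall>p. F p \<subseteq> F (Suc p)) \<and>
    subcoalgebra R C \<Delta> (F 0) \<and>
    (\<forall>p\<ge>1. \<Delta> ` F p \<subseteq>
      boxtimes R C (F (p - 1)) (carrier C) <+>\<^bsub>tensor_module R C C\<^esub> boxtimes R C (carrier C) (F (p - 1)))"

definition QT_sequence ::
    "('r, 'k) ring_scheme \<Rightarrow> ('r, 'c, 'i) module_scheme \<Rightarrow> ('c \<Rightarrow> ('c \<times> 'c \<Rightarrow> 'r) set)
      \<Rightarrow> (nat \<Rightarrow> 'c set) \<Rightarrow> bool"
  where "QT_sequence R C \<Delta> F \<longleftrightarrow> QT_filtration R C \<Delta> F \<and> (\<Union>p. F p) = carrier C"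


section \<open>Convolution\<close>

text \<open>
  \<open>sweedler R C \<Delta> S s xs\<close> says that the list \<open>xs\<close> is an expression of \<open>\<Delta> s\<close> as a finite sum of
  \<open>x \<otimes> y\<close> in \<open>C \<otimes> C\<close> with \<open>x, y\<close> in \<open>S\<close>. The convolution product on \<open>Hom(S, A)\<close> evaluates any
  such expression; \<open>S = carrier C\<close> gives \<open>Hom(C, A)\<close>, where the result does not depend on the expression
  because \<open>f x \<otimes> g y\<close> is bilinear. For a proper subcoalgebra \<open>S\<close> the map \<open>S \<otimes> S \<rightarrow> C \<otimes> C\<close> need
  not be injective, but the result is still independent of the expression as soon as \<open>f\<close> and \<open>g\<close> extend
  to \<open>C\<close>, which is automatic if \<open>Ext\<^sup>1(C/S, A) = 0\<close>.
\<close>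

definition sweedler ::
    "('r, 'k) ring_scheme \<Rightarrow> ('r, 'c, 'i) module_scheme \<Rightarrow> ('c \<Rightarrow> ('c \<times> 'c \<Rightarrow> 'r) set)
      \<Rightarrow> 'c set \<Rightarrow> 'c \<Rightarrow> ('c \<times> 'c) list \<Rightarrow> bool"
  where "sweedler R C \<Delta> S s xs \<longleftrightarrow>
    set xs \<subseteq> S \<times> S \<and> \<Delta> s = pair_sum (tensor_module R C C) (tensor R C C) xs"

definition conv ::
    "('r, 'k) ring_scheme \<Rightarrow> ('r, 'c, 'i) module_scheme \<Rightarrow> ('c \<Rightarrow> ('c \<times> 'c \<Rightarrow> 'r) set)
      \<Rightarrow> ('r, 'a, 'j) module_scheme \<Rightarrow> 'c set \<Rightarrow> ('c \<Rightarrow> 'a) \<Rightarrow> ('c \<Rightarrow> 'a) \<Rightarrow> 'c \<Rightarrow> 'a"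
  where "conv R C \<Delta> A S f g =
    (\<lambda>s\<in>S. pair_sum A (\<lambda>x y. f x \<otimes>\<^bsub>A\<^esub> g y) (SOME xs. sweedler R C \<Delta> S s xs))"

definition conv_algebra ::
    "('r, 'k) ring_scheme \<Rightarrow> ('r, 'c, 'i) module_scheme \<Rightarrow> ('c \<Rightarrow> ('c \<times> 'c \<Rightarrow> 'r) set) \<Rightarrow> ('c \<Rightarrow> 'r)
      \<Rightarrow> ('r, 'a, 'j) module_scheme \<Rightarrow> 'c set \<Rightarrow> ('c \<Rightarrow> 'a) monoid"
  where "conv_algebra R C \<Delta> \<epsilon> A S =
    \<lparr>carrier = mod_hom R (C\<lparr>carrier := S\<rparr>) A,
     mult = conv R C \<Delta> A S,
     one = (\<lambda>s\<in>S. unit_map A (\<epsilon> s))\<rparr>"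

end

(*
  Extend the inverse of the restriction of f to a map g on C, using that Ext^1(C/F_0, A) = 0. Then f * g
  and g * f agree with the unit on F_0, so it suffices to invert 1 - u in Hom(C, A) for every u that
  vanishes on F_0. For such u the power u^m vanishes on F_p as soon as m >= 2^p, because
  u^m = u^a * u^b with a, b >= 2^(p-1). Hence the geometric series of u is finite at each element
  of C, and it inverts 1 - u.
*)
theory Submission
  imports Defs
begin

section \<open>Linear maps\<close>

text \<open>The map from F_0 \<otimes> F_0 to C \<otimes> C need not be injective, so the
  convolution of two linear maps on F_0 could a priori depend on the chosen expression of
  \<open>\<Delta> s\<close>. The ring structure is therefore built on Hom(C, A) alone, and Hom(F_0,
  A) is reached only through restrictions of maps on C, for which restriction is multiplicative.
  Extending the inverse serves this purpose too. That it extends is exactness of Hom(C, A)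
  \<rightarrow> Hom(F_0, A) \<rightarrow> Ext^1(C/F_0, A), unwound on the canonical free resolution.

  The extended map g is in general no inverse of f: f \<star> g and g \<star> f are only units, one
  yielding a right inverse of f, the other a left inverse.

  The exponent that kills u grows with the stage of the filtration, so in general no partial sum of
  the series inverts 1 - u on all of C. But linearity and the inverse laws concern finitely many
  elements at a time, because a convolution at x involves only the entries of one expression of
  \<open>\<Delta> x\<close>. Those elements lie in a common stage, where a partial sum can replace
  the limit.\<close>

definition linear_map ::
    "('r, 'k) ring_scheme \<Rightarrow> ('r, 'm, 'i) module_scheme \<Rightarrow> ('r, 'n, 'j) module_scheme \<Rightarrow> ('m \<Rightarrow> 'n) \<Rightarrow> bool"
  where "linear_map R M N h \<longleftrightarrow>
    (\<forall>x\<in>carrier M. h x \<in> carrier N) \<and>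
    (\<forall>x\<in>carrier M. \<forall>y\<in>carrier M. h (x \<oplus>\<^bsub>M\<^esub> y) = h x \<oplus>\<^bsub>N\<^esub> h y) \<and>
    (\<forall>r\<in>carrier R. \<forall>x\<in>carrier M. h (r \<odot>\<^bsub>M\<^esub> x) = r \<odot>\<^bsub>N\<^esub> h x)"

lemma linear_mapI:
  assumes "\<And>x. x \<in> carrier M \<Longrightarrow> h x \<in> carrier N"
    and "\<And>x y. \<lbrakk>x \<in> carrier M; y \<in> carrier M\<rbrakk> \<Longrightarrow> h (x \<oplus>\<^bsub>M\<^esub> y) = h x \<oplus>\<^bsub>N\<^esub> h y"
    and "\<And>r x. \<lbrakk>r \<in> carrier R; x \<in> carrier M\<rbrakk> \<Longrightarrow> h (r \<odot>\<^bsub>M\<^esub> x) = r \<odot>\<^bsub>N\<^esub> h x"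
  shows "linear_map R M N h"
  using assms by (simp add: linear_map_def)

lemma linear_mapD:
  assumes "linear_map R M N h"
  shows "x \<in> carrier M \<Longrightarrow> h x \<in> carrier N"
    and "\<lbrakk>x \<in> carrier M; y \<in> carrier M\<rbrakk> \<Longrightarrow> h (x \<oplus>\<^bsub>M\<^esub> y) = h x \<oplus>\<^bsub>N\<^esub> h y"
    and "\<lbrakk>r \<in> carrier R; x \<in> carrier M\<rbrakk> \<Longrightarrow> h (r \<odot>\<^bsub>M\<^esub> x) = r \<odot>\<^bsub>N\<^esub> h x"
  using assms by (auto simp: linear_map_def)

text \<open>Linearity is split off from extensionality because the maps that are composed below,
  such as \<open>\<Delta>\<close>, \<open>free_lift\<close> and \<open>tensor_lift\<close>, are
  linear on a carrier but uncontrolled outside it. Extensionality matters only when two maps are to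
  be equal.\<close>

lemma mod_hom_iff:
  "h \<in> mod_hom R M N \<longleftrightarrow> linear_map R M N h \<and> h \<in> extensional (carrier M)"
  by (auto simp: mod_hom_def linear_map_def PiE_def Pi_def)

lemma mod_hom_linear: "h \<in> mod_hom R M N \<Longrightarrow> linear_map R M N h"
  by (simp add: mod_hom_iff)

lemma mod_hom_closed: "\<lbrakk>h \<in> mod_hom R M N; x \<in> carrier M\<rbrakk> \<Longrightarrow> h x \<in> carrier N"
  by (simp add: mod_hom_iff linear_map_def)

lemma linear_map_cong:
  assumes "module R M" "linear_map R M N h" "\<And>x. x \<in> carrier M \<Longrightarrow> h x = h' x"
  shows "linear_map R M N h'"
proof -
  interpret module R M by fact
  show ?thesis
    using linear_mapD[OF assms(2)] by (intro linear_mapI) (simp_all flip: assms(3))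
qed

lemma restrict_mod_hom:
  assumes "module R M" "linear_map R M N h"
  shows "restrict h (carrier M) \<in> mod_hom R M N"
  using linear_map_cong[OF assms, of "restrict h (carrier M)"] by (simp add: mod_hom_iff)

lemma mod_hom_eqI:
  assumes "g \<in> mod_hom R M N" "h \<in> mod_hom R M N" "\<And>x. x \<in> carrier M \<Longrightarrow> g x = h x"
  shows "g = h"
  using assms by (intro extensionalityI[of g "carrier M" h]) (auto simp: mod_hom_iff)

lemma linear_map_comp:
  assumes "linear_map R M N h" "linear_map R N P k"
  shows "linear_map R M P (\<lambda>x. k (h x))"
  using assms by (simp add: linear_map_def)

lemma linear_map_zero:
  assumes "module R M" "module R N" "linear_map R M N h"
  shows "h \<zero>\<^bsub>M\<^esub> = \<zero>\<^bsub>N\<^esub>"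
proof -
  interpret M: module R M by fact
  interpret N: module R N by fact
  have "h (\<zero>\<^bsub>R\<^esub> \<odot>\<^bsub>M\<^esub> \<zero>\<^bsub>M\<^esub>) = \<zero>\<^bsub>R\<^esub> \<odot>\<^bsub>N\<^esub> h \<zero>\<^bsub>M\<^esub>"
    using linear_mapD(3)[OF assms(3)] by blast
  then show ?thesis
    using linear_mapD(1)[OF assms(3)] by simp
qed

lemma linear_map_minus:
  assumes "module R M" "module R N" "linear_map R M N h" "x \<in> carrier M" "y \<in> carrier M"
  shows "h (x \<ominus>\<^bsub>M\<^esub> y) = h x \<ominus>\<^bsub>N\<^esub> h y"
proof -
  interpret M: module R M by fact
  interpret N: module R N by fact
  note [simp] = linear_mapD[OF assms(3)]
  have "h (\<ominus>\<^bsub>M\<^esub> y) \<oplus>\<^bsub>N\<^esub> h y = h (\<ominus>\<^bsub>M\<^esub> y \<oplus>\<^bsub>M\<^esub> y)"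
    using assms by simp
  also have "\<dots> = \<zero>\<^bsub>N\<^esub>"
    using assms linear_map_zero[OF assms(1-3)] by (simp add: M.M.l_neg)
  finally have "\<ominus>\<^bsub>N\<^esub> h y = h (\<ominus>\<^bsub>M\<^esub> y)"
    using assms by (intro N.M.minus_equality) auto
  then show ?thesis
    using assms by (simp add: a_minus_def)
qed

lemma linear_map_add:
  assumes "module R M" "module R N" "linear_map R M N g" "linear_map R M N h"
  shows "linear_map R M N (\<lambda>x. g x \<oplus>\<^bsub>N\<^esub> h x)"
proof -
  interpret M: module R M by fact
  interpret N: module R N by fact
  show ?thesis
    using linear_mapD[OF assms(3)] linear_mapD[OF assms(4)]
    by (intro linear_mapI) (auto simp: N.smult_r_distr N.M.a_ac)
qed

lemma linear_map_smult:
  assumes "module R M" "module R N" "linear_map R M N h" "r \<in> carrier R"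
  shows "linear_map R M N (\<lambda>x. r \<odot>\<^bsub>N\<^esub> h x)"
proof -
  interpret M: module R M by fact
  interpret N: module R N by fact
  show ?thesis
    using linear_mapD[OF assms(3)] assms(4)
    by (intro linear_mapI) (auto simp: N.smult_r_distr M.R.m_comm simp flip: N.smult_assoc1)
qed

lemma linear_map_zero_fun:
  assumes "module R N"
  shows "linear_map R M N (\<lambda>x. \<zero>\<^bsub>N\<^esub>)"
proof -
  interpret N: module R N by fact
  show ?thesis by (intro linear_mapI) auto
qed

lemma kernel_submodule:
  assumes "module R M" "module R N" "linear_map R M N h"
  shows "submodule {x \<in> carrier M. h x = \<zero>\<^bsub>N\<^esub>} R M"
proof -
  interpret M: module R M by fact
  interpret N: module R N by fact
  have "h (\<ominus>\<^bsub>M\<^esub> x) = \<zero>\<^bsub>N\<^esub>" if "x \<in> carrier M" "h x = \<zero>\<^bsub>N\<^esub>" for x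
    using linear_map_minus[OF assms, of "\<zero>\<^bsub>M\<^esub>" x] that linear_map_zero[OF assms]
    by (simp add: a_minus_def)
  then show ?thesis
    using linear_mapD[OF assms(3)] linear_map_zero[OF assms]
    by (intro M.submoduleI) auto
qed

lemma submodule_zero:
  assumes "submodule N R M"
  shows "\<zero>\<^bsub>M\<^esub> \<in> N"
  using subgroup.one_closed[OF submodule.axioms(1)[OF assms]] by simp

section \<open>Free modules\<close>

lemma free_module_carrier:
  "carrier (free_module R X) =
    {v. range v \<subseteq> carrier R \<and> finite {x. v x \<noteq> \<zero>\<^bsub>R\<^esub>} \<and> {x. v x \<noteq> \<zero>\<^bsub>R\<^esub>} \<subseteq> X}"
  by (simp add: free_module_def)

lemma free_module_sel [simp]:
  "\<zero>\<^bsub>free_module R X\<^esub> = (\<lambda>x. \<zero>\<^bsub>R\<^esub>)"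
  "v \<oplus>\<^bsub>free_module R X\<^esub> w = (\<lambda>x. v x \<oplus>\<^bsub>R\<^esub> w x)"
  "r \<odot>\<^bsub>free_module R X\<^esub> v = (\<lambda>x. r \<otimes>\<^bsub>R\<^esub> v x)"
  by (simp_all add: free_module_def)

lemma free_module_memD:
  assumes "v \<in> carrier (free_module R X)"
  shows "v x \<in> carrier R" and "finite {x. v x \<noteq> \<zero>\<^bsub>R\<^esub>}" and "v x \<noteq> \<zero>\<^bsub>R\<^esub> \<Longrightarrow> x \<in> X"
  using assms by (auto simp: free_module_carrier)

lemma free_module_memI:
  assumes "\<And>x. v x \<in> carrier R" "finite B" "B \<subseteq> X" "\<And>x. x \<notin> B \<Longrightarrow> v x = \<zero>\<^bsub>R\<^esub>"
  shows "v \<in> carrier (free_module R X)"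
proof -
  have "{x. v x \<noteq> \<zero>\<^bsub>R\<^esub>} \<subseteq> B" using assms(4) by blast
  then show ?thesis using assms(1,2,3) finite_subset by (auto simp: free_module_carrier)
qed

lemma free_module_module:
  assumes "cring R"
  shows "module R (free_module R X)"
proof -
  interpret R: cring R by fact
  let ?F = "free_module R X"
  note cl = free_module_memD
  have add: "v \<oplus>\<^bsub>?F\<^esub> w \<in> carrier ?F" if "v \<in> carrier ?F" "w \<in> carrier ?F" for v w
    by (rule free_module_memI[where B = "{x. v x \<noteq> \<zero>\<^bsub>R\<^esub>} \<union> {x. w x \<noteq> \<zero>\<^bsub>R\<^esub>}"])
       (use cl[OF that(1)] cl[OF that(2)] in auto)
  have smult: "r \<odot>\<^bsub>?F\<^esub> v \<in> carrier ?F" if "r \<in> carrier R" "v \<in> carrier ?F" for r v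
    by (rule free_module_memI[where B = "{x. v x \<noteq> \<zero>\<^bsub>R\<^esub>}"])
       (use that(1) cl[OF that(2)] in auto)
  have inv: "\<exists>w\<in>carrier ?F. w \<oplus>\<^bsub>?F\<^esub> v = \<zero>\<^bsub>?F\<^esub>" if "v \<in> carrier ?F" for v
  proof
    show "(\<lambda>x. \<ominus>\<^bsub>R\<^esub> v x) \<in> carrier ?F"
      by (rule free_module_memI[where B = "{x. v x \<noteq> \<zero>\<^bsub>R\<^esub>}"])
         (use cl[OF that] in auto)
    show "(\<lambda>x. \<ominus>\<^bsub>R\<^esub> v x) \<oplus>\<^bsub>?F\<^esub> v = \<zero>\<^bsub>?F\<^esub>"
      using cl(1)[OF that] by (simp add: R.l_neg)
  qed
  have zero: "\<zero>\<^bsub>?F\<^esub> \<in> carrier ?F" by (rule free_module_memI[where B = "{}"]) auto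
  have "abelian_group ?F"
    by (rule abelian_groupI; (intro add zero inv)?)
       (simp_all add: cl(1) R.a_ac fun_eq_iff)
  then show ?thesis
    by (rule moduleI[OF assms]; (intro smult)?)
       (simp_all add: cl(1) R.l_distr R.r_distr R.m_assoc fun_eq_iff)
qed

lemma basis_elt_closed:
  assumes "cring R" "x \<in> X"
  shows "basis_elt R x \<in> carrier (free_module R X)"
proof -
  interpret R: cring R by fact
  show ?thesis
    by (rule free_module_memI[where B = "{x}"]) (use assms(2) in \<open>auto simp: basis_elt_def\<close>)
qed

text \<open>Induction on a finite set \<open>B\<close> that contains the support: the coefficient at
  the new point \<open>b\<close> is cleared by \<open>v(b := \<zero>)\<close> and added back as a
  multiple of the basis element. Asking only that \<open>B\<close> contain the support allows the
  coefficient at \<open>b\<close> to be zero.\<close>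

lemma free_module_induct [consumes 2, case_names zero add]:
  assumes "cring R" "v \<in> carrier (free_module R X)"
    and zero: "Q \<zero>\<^bsub>free_module R X\<^esub>"
    and add: "\<And>v r x. \<lbrakk>v \<in> carrier (free_module R X); Q v; r \<in> carrier R; x \<in> X\<rbrakk> \<Longrightarrow>
      Q (v \<oplus>\<^bsub>free_module R X\<^esub> r \<odot>\<^bsub>free_module R X\<^esub> basis_elt R x)"
  shows "Q v"
proof -
  interpret R: cring R by fact
  have "finite B \<Longrightarrow> B \<subseteq> X \<Longrightarrow> v \<in> carrier (free_module R X) \<Longrightarrow> {x. v x \<noteq> \<zero>\<^bsub>R\<^esub>} \<subseteq> B \<Longrightarrow> Q v" for B
  proof (induction B arbitrary: v rule: finite_induct)
    case empty
    then have "v = \<zero>\<^bsub>free_module R X\<^esub>" by auto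
    then show ?case using zero by simp
  next
    case (insert b B)
    let ?w = "v(b := \<zero>\<^bsub>R\<^esub>)"
    note cl = free_module_memD[OF insert.prems(2)]
    have w: "?w \<in> carrier (free_module R X)"
      by (rule free_module_memI[where B = B]) (use insert cl in auto)
    have "{x. ?w x \<noteq> \<zero>\<^bsub>R\<^esub>} \<subseteq> B" using insert.prems by (auto split: if_splits)
    with w have "Q ?w" using insert.prems(1) by (intro insert.IH; (assumption | blast))
    with w have "Q (?w \<oplus>\<^bsub>free_module R X\<^esub> v b \<odot>\<^bsub>free_module R X\<^esub> basis_elt R b)"
      using insert.prems(1) cl(1) by (intro add) auto
    moreover have "?w \<oplus>\<^bsub>free_module R X\<^esub> v b \<odot>\<^bsub>free_module R X\<^esub> basis_elt R b = v"
      using cl(1) by (auto simp: basis_elt_def)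
    ultimately show ?case by simp
  qed
  from this[of "{x. v x \<noteq> \<zero>\<^bsub>R\<^esub>}"] show ?thesis
    using assms(2) free_module_memD[OF assms(2)] by auto
qed

text \<open>The support over which \<open>free_lift\<close> sums varies with the vector. Terms
  outside it vanish, so two vectors and their sum can be compared over one common index set.\<close>

lemma free_lift_eq:
  assumes "module R M" "v \<in> carrier (free_module R X)"
    and "finite B" "{x. v x \<noteq> \<zero>\<^bsub>R\<^esub>} \<subseteq> B" "\<phi> \<in> B \<rightarrow> carrier M"
  shows "free_lift R M \<phi> v = (\<Oplus>\<^bsub>M\<^esub>x\<in>B. v x \<odot>\<^bsub>M\<^esub> \<phi> x)"
  unfolding free_lift_def
proof -
  interpret module R M by fact
  note cl = free_module_memD(1)[OF assms(2)]
  show "(\<Oplus>\<^bsub>M\<^esub>x\<in>{x. v x \<noteq> \<zero>\<^bsub>R\<^esub>}. v x \<odot>\<^bsub>M\<^esub> \<phi> x) = (\<Oplus>\<^bsub>M\<^esub>x\<in>B. v x \<odot>\<^bsub>M\<^esub> \<phi> x)"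
    by (rule M.add.finprod_mono_neutral_cong_left) (use assms cl in \<open>auto simp: Pi_iff\<close>)
qed

lemma free_lift_linear:
  assumes "module R M" "\<phi> \<in> X \<rightarrow> carrier M"
  shows "linear_map R (free_module R X) M (free_lift R M \<phi>)"
proof -
  interpret M: module R M by fact
  let ?F = "free_module R X"
  interpret F: module R ?F by (rule free_module_module) unfold_locales
  note cl = free_module_memD
  show ?thesis
  proof (rule linear_mapI)
    fix v assume v: "v \<in> carrier ?F"
    show "free_lift R M \<phi> v \<in> carrier M"
      unfolding free_lift_def using cl[OF v] assms(2) by (intro M.M.finsum_closed) auto
  next
    fix v w assume v: "v \<in> carrier ?F" and w: "w \<in> carrier ?F"
    let ?B = "{x. v x \<noteq> \<zero>\<^bsub>R\<^esub>} \<union> {x. w x \<noteq> \<zero>\<^bsub>R\<^esub>}"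
    have B: "finite ?B" "\<phi> \<in> ?B \<rightarrow> carrier M" using cl[OF v] cl[OF w] assms(2) by auto
    have "free_lift R M \<phi> (v \<oplus>\<^bsub>?F\<^esub> w) = (\<Oplus>\<^bsub>M\<^esub>x\<in>?B. (v \<oplus>\<^bsub>?F\<^esub> w) x \<odot>\<^bsub>M\<^esub> \<phi> x)"
      by (rule free_lift_eq[OF assms(1) F.M.a_closed[OF v w] B(1) _ B(2)]) auto
    also have "\<dots> = (\<Oplus>\<^bsub>M\<^esub>x\<in>?B. v x \<odot>\<^bsub>M\<^esub> \<phi> x \<oplus>\<^bsub>M\<^esub> w x \<odot>\<^bsub>M\<^esub> \<phi> x)"
      using B(2) cl(1)[OF v] cl(1)[OF w]
      by (intro M.M.finsum_cong') (auto simp: M.smult_l_distr Pi_iff)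
    also have "\<dots> = (\<Oplus>\<^bsub>M\<^esub>x\<in>?B. v x \<odot>\<^bsub>M\<^esub> \<phi> x) \<oplus>\<^bsub>M\<^esub> (\<Oplus>\<^bsub>M\<^esub>x\<in>?B. w x \<odot>\<^bsub>M\<^esub> \<phi> x)"
      using B(2) cl(1)[OF v] cl(1)[OF w] by (intro M.M.finsum_addf) (auto simp: Pi_iff)
    finally show "free_lift R M \<phi> (v \<oplus>\<^bsub>?F\<^esub> w) = free_lift R M \<phi> v \<oplus>\<^bsub>M\<^esub> free_lift R M \<phi> w"
      using free_lift_eq[OF assms(1) v B(1) _ B(2)] free_lift_eq[OF assms(1) w B(1) _ B(2)] by auto
  next
    fix r v assume r: "r \<in> carrier R" and v: "v \<in> carrier ?F"
    let ?B = "{x. v x \<noteq> \<zero>\<^bsub>R\<^esub>}"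
    have B: "finite ?B" "\<phi> \<in> ?B \<rightarrow> carrier M" using cl[OF v] assms(2) by auto
    have "free_lift R M \<phi> (r \<odot>\<^bsub>?F\<^esub> v) = (\<Oplus>\<^bsub>M\<^esub>x\<in>?B. (r \<odot>\<^bsub>?F\<^esub> v) x \<odot>\<^bsub>M\<^esub> \<phi> x)"
      by (rule free_lift_eq[OF assms(1) F.smult_closed[OF r v] B(1) _ B(2)]) (use r in auto)
    also have "\<dots> = (\<Oplus>\<^bsub>M\<^esub>x\<in>?B. r \<odot>\<^bsub>M\<^esub> (v x \<odot>\<^bsub>M\<^esub> \<phi> x))"
      using B(2) cl(1)[OF v] r
      by (intro M.M.finsum_cong') (auto simp: M.smult_assoc1 Pi_iff)
    also have "\<dots> = r \<odot>\<^bsub>M\<^esub> (\<Oplus>\<^bsub>M\<^esub>x\<in>?B. v x \<odot>\<^bsub>M\<^esub> \<phi> x)"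
      using B cl(1)[OF v] r by (intro M.finsum_smult_ldistr[symmetric]) (auto simp: Pi_iff)
    finally show "free_lift R M \<phi> (r \<odot>\<^bsub>?F\<^esub> v) = r \<odot>\<^bsub>M\<^esub> free_lift R M \<phi> v"
      by (simp add: free_lift_def)
  qed
qed

lemma free_lift_basis:
  assumes "module R M" "\<phi> x \<in> carrier M"
  shows "free_lift R M \<phi> (basis_elt R x) = \<phi> x"
proof -
  interpret M: module R M by fact
  have "free_lift R M \<phi> (basis_elt R x) = (\<Oplus>\<^bsub>M\<^esub>y\<in>{x}. basis_elt R x y \<odot>\<^bsub>M\<^esub> \<phi> y)"
    by (rule free_lift_eq[OF assms(1), where X = "{x}"])
       (use assms basis_elt_closed[OF M.R.is_cring, of x "{x}"] in \<open>auto simp: basis_elt_def\<close>)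
  then show ?thesis using assms(2) by (simp add: basis_elt_def)
qed

text \<open>The uniqueness half of the universal property of free modules, by induction on the
  vector.\<close>

lemma free_linear_eqI:
  assumes "module R M" "linear_map R (free_module R X) M g" "linear_map R (free_module R X) M h"
    and "\<And>x. x \<in> X \<Longrightarrow> g (basis_elt R x) = h (basis_elt R x)"
    and "v \<in> carrier (free_module R X)"
  shows "g v = h v"
proof -
  interpret M: module R M by fact
  have cr: "cring R" by unfold_locales
  interpret F: module R "free_module R X" by (rule free_module_module[OF cr])
  note m = F.module_axioms assms(1)
  from cr assms(5) show ?thesis
  proof (induction rule: free_module_induct)
    case zero
    then show ?case using linear_map_zero[OF m] assms(2,3) by metis
  next
    case (add v r x)
    have b: "basis_elt R x \<in> carrier (free_module R X)" by (rule basis_elt_closed[OF cr add.hyps(3)])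
    from add b show ?case
      by (simp only: F.smult_closed linear_mapD[OF assms(2)] linear_mapD[OF assms(3)] assms(4))
  qed
qed

text \<open>Both sides are linear in \<open>v\<close> and take the value \<open>h (\<phi> x)\<close>
  at the basis element of \<open>x\<close>.\<close>

lemma linear_map_free_lift:
  assumes "module R M" "module R N" "linear_map R M N h" "\<phi> \<in> X \<rightarrow> carrier M"
    and "v \<in> carrier (free_module R X)"
  shows "h (free_lift R M \<phi> v) = free_lift R N (\<lambda>x. h (\<phi> x)) v"
proof -
  have h\<phi>: "(\<lambda>x. h (\<phi> x)) \<in> X \<rightarrow> carrier N"
    using linear_mapD(1)[OF assms(3)] assms(4) by auto
  show ?thesis
  proof (rule free_linear_eqI[OF assms(2) linear_map_comp[OF free_lift_linear[OF assms(1,4)] assms(3)]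
        free_lift_linear[OF assms(2) h\<phi>] _ assms(5)])
    fix x assume "x \<in> X"
    then have "\<phi> x \<in> carrier M" "h (\<phi> x) \<in> carrier N" using assms(4) h\<phi> by auto
    then show "h (free_lift R M \<phi> (basis_elt R x)) = free_lift R N (\<lambda>x. h (\<phi> x)) (basis_elt R x)"
      by (simp add: free_lift_basis[OF assms(1)] free_lift_basis[OF assms(2)])
  qed
qed

lemma free_lift_cong:
  assumes "module R M" "\<phi> \<in> X \<rightarrow> carrier M" "\<And>x. x \<in> X \<Longrightarrow> \<phi> x = \<psi> x"
    and "v \<in> carrier (free_module R X)"
  shows "free_lift R M \<phi> v = free_lift R M \<psi> v"
proof -
  have psi: "\<psi> \<in> X \<rightarrow> carrier M" using assms(2,3) by (metis Pi_iff)
  show ?thesis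
  proof (rule free_linear_eqI[OF assms(1) free_lift_linear[OF assms(1,2)] free_lift_linear[OF assms(1) psi] _ assms(4)])
    fix x assume x: "x \<in> X"
    then have "\<phi> x \<in> carrier M" "\<psi> x \<in> carrier M" using assms(2) psi by auto
    then show "free_lift R M \<phi> (basis_elt R x) = free_lift R M \<psi> (basis_elt R x)"
      using assms(3)[OF x] by (simp add: free_lift_basis[OF assms(1)])
  qed
qed

section \<open>Quotients\<close>

context
  fixes R :: "('r, 'k) ring_scheme" and M :: "('r, 'm, 'i) module_scheme" and N :: "'m set"
  assumes M: "module R M" and N: "submodule N R M"
begin

interpretation M: module R M by (rule M)

interpretation N: abelian_subgroup N M
  by (rule abelian_subgroupI3[OF additive_subgroup.intro[OF submodule.axioms(1)[OF N]]]) unfold_locales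

lemma quot_module_sel [simp]:
  "carrier (quot_module M N) = (\<lambda>x. N +>\<^bsub>M\<^esub> x) ` carrier M"
  "\<zero>\<^bsub>quot_module M N\<^esub> = N"
  "X \<oplus>\<^bsub>quot_module M N\<^esub> Y = X <+>\<^bsub>M\<^esub> Y"
  by (auto simp: quot_module_def A_RCOSETS_def')

lemma coset_eq_iff:
  assumes "x \<in> carrier M" "y \<in> carrier M"
  shows "N +>\<^bsub>M\<^esub> x = N +>\<^bsub>M\<^esub> y \<longleftrightarrow> x \<ominus>\<^bsub>M\<^esub> y \<in> N"
proof -
  have "N +>\<^bsub>M\<^esub> x = N +>\<^bsub>M\<^esub> y \<longleftrightarrow> x \<in> N +>\<^bsub>M\<^esub> y"
    using assms N.a_rcos_self N.a_repr_independence' N.a_repr_independenceD by metis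
  also have "\<dots> \<longleftrightarrow> x \<ominus>\<^bsub>M\<^esub> y \<in> N"
    using N.a_rcos_module[of y x] assms by (simp add: a_minus_def)
  finally show ?thesis .
qed

lemma coset_zero: "N +>\<^bsub>M\<^esub> \<zero>\<^bsub>M\<^esub> = N"
  using N.a_subset by simp

text \<open>\<open>quot_module\<close> defines the scalar multiple of a coset as a union over all
  its representatives. The union collapses because r (y - x) lies in \<open>N\<close> whenever y - x
  does, so every representative contributes the same coset.\<close>

lemma coset_smult:
  assumes "r \<in> carrier R" "x \<in> carrier M"
  shows "r \<odot>\<^bsub>quot_module M N\<^esub> (N +>\<^bsub>M\<^esub> x) = N +>\<^bsub>M\<^esub> (r \<odot>\<^bsub>M\<^esub> x)"
proof -
  have "N +>\<^bsub>M\<^esub> (r \<odot>\<^bsub>M\<^esub> y) = N +>\<^bsub>M\<^esub> (r \<odot>\<^bsub>M\<^esub> x)" if "y \<in> N +>\<^bsub>M\<^esub> x" for y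
  proof -
    have y: "y \<in> carrier M" using that N.a_elemrcos_carrier assms by blast
    have "y \<ominus>\<^bsub>M\<^esub> x \<in> N" using that y assms coset_eq_iff N.a_repr_independence' by metis
    then have "r \<odot>\<^bsub>M\<^esub> (y \<ominus>\<^bsub>M\<^esub> x) \<in> N" using submodule.smult_closed[OF N] assms by blast
    then show ?thesis
      using assms y by (simp add: coset_eq_iff a_minus_def M.smult_r_distr M.smult_r_minus)
  qed
  moreover have "x \<in> N +>\<^bsub>M\<^esub> x" using assms N.a_rcos_self by blast
  ultimately have "(\<Union>y\<in>N +>\<^bsub>M\<^esub> x. N +>\<^bsub>M\<^esub> (r \<odot>\<^bsub>M\<^esub> y)) = N +>\<^bsub>M\<^esub> (r \<odot>\<^bsub>M\<^esub> x)" by blast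
  then show ?thesis by (simp add: quot_module_def)
qed

lemma coset_add:
  assumes "x \<in> carrier M" "y \<in> carrier M"
  shows "(N +>\<^bsub>M\<^esub> x) <+>\<^bsub>M\<^esub> (N +>\<^bsub>M\<^esub> y) = N +>\<^bsub>M\<^esub> (x \<oplus>\<^bsub>M\<^esub> y)"
  using assms by (rule N.a_rcos_sum)

lemma quot_module_module: "module R (quot_module M N)"
proof -
  let ?Q = "quot_module M N"
  have "abelian_group ?Q"
  proof (rule abelian_groupI)
    show "\<zero>\<^bsub>?Q\<^esub> \<in> carrier ?Q" using coset_zero
      by (metis M.M.zero_closed imageI quot_module_sel(1) quot_module_sel(2))
  next
    fix X assume "X \<in> carrier ?Q"
    then obtain x where x: "x \<in> carrier M" "X = N +>\<^bsub>M\<^esub> x" by auto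
    then have "(N +>\<^bsub>M\<^esub> (\<ominus>\<^bsub>M\<^esub> x)) \<oplus>\<^bsub>?Q\<^esub> X = \<zero>\<^bsub>?Q\<^esub>"
      using coset_zero by (simp add: coset_add M.M.l_neg)
    moreover have "N +>\<^bsub>M\<^esub> (\<ominus>\<^bsub>M\<^esub> x) \<in> carrier ?Q" using x by simp
    ultimately show "\<exists>Y\<in>carrier ?Q. Y \<oplus>\<^bsub>?Q\<^esub> X = \<zero>\<^bsub>?Q\<^esub>" by (rule bexI)
    have "(N +>\<^bsub>M\<^esub> \<zero>\<^bsub>M\<^esub>) \<oplus>\<^bsub>?Q\<^esub> X = X"
      using x by (simp add: coset_add del: M.a_coset_add_zero)
    then show "\<zero>\<^bsub>?Q\<^esub> \<oplus>\<^bsub>?Q\<^esub> X = X" using coset_zero by simp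
  next
    fix X Y Z assume "X \<in> carrier ?Q" "Y \<in> carrier ?Q" "Z \<in> carrier ?Q"
    then show "X \<oplus>\<^bsub>?Q\<^esub> Y \<oplus>\<^bsub>?Q\<^esub> Z = X \<oplus>\<^bsub>?Q\<^esub> (Y \<oplus>\<^bsub>?Q\<^esub> Z)"
      by (auto simp: coset_add M.M.a_assoc)
  next
    fix X Y assume X: "X \<in> carrier ?Q" and Y: "Y \<in> carrier ?Q"
    then show "X \<oplus>\<^bsub>?Q\<^esub> Y \<in> carrier ?Q"
      by (auto simp: coset_add)
    show "X \<oplus>\<^bsub>?Q\<^esub> Y = Y \<oplus>\<^bsub>?Q\<^esub> X"
      using X Y by (auto simp: coset_add M.M.a_comm)
  qed
  with M.R.is_cring show ?thesis
  proof (rule moduleI)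
    fix r X assume "r \<in> carrier R" "X \<in> carrier ?Q"
    then show "r \<odot>\<^bsub>?Q\<^esub> X \<in> carrier ?Q" by (auto simp: coset_smult)
  next
    fix a b X assume "a \<in> carrier R" "b \<in> carrier R" "X \<in> carrier ?Q"
    then show "(a \<oplus>\<^bsub>R\<^esub> b) \<odot>\<^bsub>?Q\<^esub> X = a \<odot>\<^bsub>?Q\<^esub> X \<oplus>\<^bsub>?Q\<^esub> b \<odot>\<^bsub>?Q\<^esub> X"
      by (auto simp: coset_add coset_smult M.smult_l_distr)
  next
    fix r X Y assume "r \<in> carrier R" "X \<in> carrier ?Q" "Y \<in> carrier ?Q"
    then show "r \<odot>\<^bsub>?Q\<^esub> (X \<oplus>\<^bsub>?Q\<^esub> Y) = r \<odot>\<^bsub>?Q\<^esub> X \<oplus>\<^bsub>?Q\<^esub> r \<odot>\<^bsub>?Q\<^esub> Y"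
      by (auto simp: coset_add coset_smult M.smult_r_distr)
  next
    fix a b X assume "a \<in> carrier R" "b \<in> carrier R" "X \<in> carrier ?Q"
    then show "(a \<otimes>\<^bsub>R\<^esub> b) \<odot>\<^bsub>?Q\<^esub> X = a \<odot>\<^bsub>?Q\<^esub> (b \<odot>\<^bsub>?Q\<^esub> X)"
      by (auto simp: coset_smult M.smult_assoc1)
  next
    fix X assume "X \<in> carrier ?Q"
    then show "\<one>\<^bsub>R\<^esub> \<odot>\<^bsub>?Q\<^esub> X = X"
      by (auto simp: coset_smult)
  qed
qed

lemma quot_proj_linear: "linear_map R M (quot_module M N) (\<lambda>x. N +>\<^bsub>M\<^esub> x)"
proof (rule linear_mapI)
  fix x y assume "x \<in> carrier M" "y \<in> carrier M"
  then show "N +>\<^bsub>M\<^esub> (x \<oplus>\<^bsub>M\<^esub> y) = (N +>\<^bsub>M\<^esub> x) \<oplus>\<^bsub>quot_module M N\<^esub> (N +>\<^bsub>M\<^esub> y)"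
    by (simp only: quot_module_sel coset_add)
next
  fix r x assume "r \<in> carrier R" "x \<in> carrier M"
  then show "N +>\<^bsub>M\<^esub> (r \<odot>\<^bsub>M\<^esub> x) = r \<odot>\<^bsub>quot_module M N\<^esub> (N +>\<^bsub>M\<^esub> x)"
    by (simp only: coset_smult)
qed simp

text \<open>This makes the \<open>the_elem\<close> in \<open>tensor_lift\<close> meaningful: a
  linear map that kills \<open>N\<close> is constant on each coset of \<open>N\<close>.\<close>

lemma coset_image:
  assumes "module R P" "linear_map R M P h" "\<And>x. x \<in> N \<Longrightarrow> h x = \<zero>\<^bsub>P\<^esub>" "x \<in> carrier M"
  shows "h ` (N +>\<^bsub>M\<^esub> x) = {h x}"
proof -
  interpret P: module R P by fact
  have "h y = h x" if "y \<in> N +>\<^bsub>M\<^esub> x" for y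
  proof -
    from that obtain n where n: "n \<in> N" "y = n \<oplus>\<^bsub>M\<^esub> x" unfolding a_r_coset_def r_coset_def by auto
    then show ?thesis
      using assms N.a_Hcarr linear_mapD[OF assms(2)] by simp
  qed
  moreover have "x \<in> N +>\<^bsub>M\<^esub> x" using assms N.a_rcos_self by blast
  ultimately show ?thesis by blast
qed

end

section \<open>Tensor products\<close>

context
  fixes R :: "('r, 'k) ring_scheme" and M :: "('r, 'm, 'i) module_scheme" and X :: "'m set"
  assumes M: "module R M" and X: "X \<subseteq> carrier M"
begin

interpretation M: module R M by (rule M)

lemma span_module_submodule: "submodule (span_module R M X) R M"
proof -
  \<comment> \<open>The carrier is itself one of the submodules being intersected, which keeps the
    intersection inside it.\<close>
  have "span_module R M X \<subseteq> carrier M"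
    using M.carrier_is_submodule X by (auto simp: span_module_def)
  then show ?thesis
    by (intro M.submoduleI) (auto simp: span_module_def submodule_zero M.submoduleE)
qed

lemma span_module_superset: "X \<subseteq> span_module R M X"
  by (auto simp: span_module_def)

lemma span_module_least: "\<lbrakk>submodule N R M; X \<subseteq> N\<rbrakk> \<Longrightarrow> span_module R M X \<subseteq> N"
  by (auto simp: span_module_def)

end

section \<open>Bilinear maps and the universal property of the tensor product\<close>

definition bilinear_map ::
    "('r, 'k) ring_scheme \<Rightarrow> ('r, 'm, 'i) module_scheme \<Rightarrow> ('r, 'n, 'j) module_scheme
      \<Rightarrow> ('r, 'p, 'l) module_scheme \<Rightarrow> ('m \<Rightarrow> 'n \<Rightarrow> 'p) \<Rightarrow> bool"
  where "bilinear_map R M N P \<beta> \<longleftrightarrow>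
    (\<forall>x\<in>carrier M. linear_map R N P (\<beta> x)) \<and> (\<forall>y\<in>carrier N. linear_map R M P (\<lambda>x. \<beta> x y))"

lemma bilinear_mapI:
  assumes "\<And>x. x \<in> carrier M \<Longrightarrow> linear_map R N P (\<beta> x)"
    and "\<And>y. y \<in> carrier N \<Longrightarrow> linear_map R M P (\<lambda>x. \<beta> x y)"
  shows "bilinear_map R M N P \<beta>"
  using assms by (simp add: bilinear_map_def)

lemma bilinear_mapD:
  assumes "bilinear_map R M N P \<beta>"
  shows "x \<in> carrier M \<Longrightarrow> linear_map R N P (\<beta> x)"
    and "y \<in> carrier N \<Longrightarrow> linear_map R M P (\<lambda>x. \<beta> x y)"
  using assms by (simp_all add: bilinear_map_def)

lemma bilinear_map_closed:
  assumes "bilinear_map R M N P \<beta>" "x \<in> carrier M" "y \<in> carrier N"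
  shows "\<beta> x y \<in> carrier P"
  using assms by (simp add: bilinear_map_def linear_map_def)

context
  fixes R :: "('r, 'k) ring_scheme"
    and M :: "('r, 'm, 'i) module_scheme" and N :: "('r, 'n, 'j) module_scheme"
  assumes M: "module R M" and N: "module R N"
begin

interpretation M: module R M by (rule M)
interpretation N: module R N by (rule N)

abbreviation (input) "tensor_free \<equiv> free_module R (carrier M \<times> carrier N)"

interpretation F: module R tensor_free by (rule free_module_module[OF M.R.is_cring])

lemma tensor_basis_closed:
  assumes "x \<in> carrier M" "y \<in> carrier N"
  shows "basis_elt R (x, y) \<in> carrier tensor_free"
  using assms by (intro basis_elt_closed M.R.is_cring) auto

lemma tensor_rels_closed: "tensor_rels R M N \<subseteq> carrier tensor_free"
  unfolding tensor_rels_def Let_def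
  by (auto simp del: free_module_sel simp: tensor_basis_closed)

lemma tensor_ker_submodule: "submodule (tensor_ker R M N) R tensor_free"
  unfolding tensor_ker_def by (rule span_module_submodule[OF F.module_axioms tensor_rels_closed])

lemma tensor_module_module: "module R (tensor_module R M N)"
  unfolding tensor_module_def by (rule quot_module_module[OF F.module_axioms tensor_ker_submodule])

lemma tensor_rels_tensor_ker: "t \<in> tensor_rels R M N \<Longrightarrow> t \<in> tensor_ker R M N"
  using span_module_superset[OF F.module_axioms tensor_rels_closed] unfolding tensor_ker_def by blast

lemma tensor_proj_linear:
  "linear_map R tensor_free (tensor_module R M N) (\<lambda>v. tensor_ker R M N +>\<^bsub>tensor_free\<^esub> v)"
  unfolding tensor_module_def by (rule quot_proj_linear[OF F.module_axioms tensor_ker_submodule])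

lemma tensor_closed:
  assumes "x \<in> carrier M" "y \<in> carrier N"
  shows "tensor R M N x y \<in> carrier (tensor_module R M N)"
  unfolding tensor_def using linear_mapD(1)[OF tensor_proj_linear tensor_basis_closed[OF assms]] .

text \<open>Each law of bilinearity is one of the four families of generators in
  \<open>tensor_rels\<close>: the two sides have representatives in the free module that differ by a
  generator, hence equal cosets, and linearity of the projection splits the right-hand
  coset.\<close>

lemma tensor_bilinear: "bilinear_map R M N (tensor_module R M N) (tensor R M N)"
proof -
  \<comment> \<open>These rules would turn the operations of the free module into pointwise
    functions, after which the generators could no longer be recognized.\<close>
  note [simp del] = free_module_sel
  note [simp] = tensor_basis_closed
  have eq: "tensor_ker R M N +>\<^bsub>tensor_free\<^esub> v = tensor_ker R M N +>\<^bsub>tensor_free\<^esub> w"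
    if "v \<ominus>\<^bsub>tensor_free\<^esub> w \<in> tensor_rels R M N" "v \<in> carrier tensor_free" "w \<in> carrier tensor_free" for v w
    using that tensor_rels_tensor_ker coset_eq_iff[OF F.module_axioms tensor_ker_submodule] by blast
  show ?thesis
  proof (intro bilinear_mapI linear_mapI tensor_closed; assumption?)
    fix x y y' assume *: "x \<in> carrier M" "y \<in> carrier N" "y' \<in> carrier N"
    have "tensor_ker R M N +>\<^bsub>tensor_free\<^esub> basis_elt R (x, y \<oplus>\<^bsub>N\<^esub> y') = tensor_ker R M N +>\<^bsub>tensor_free\<^esub> (basis_elt R (x, y) \<oplus>\<^bsub>tensor_free\<^esub> basis_elt R (x, y'))"
      by (rule eq) (use * in \<open>(simp only: tensor_rels_def Let_def, blast) | simp\<close>)+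
    then show "tensor R M N x (y \<oplus>\<^bsub>N\<^esub> y') =
        tensor R M N x y \<oplus>\<^bsub>tensor_module R M N\<^esub> tensor R M N x y'"
      by (simp only: tensor_def linear_mapD(2)[OF tensor_proj_linear] tensor_basis_closed *)
  next
    fix x x' y assume *: "x \<in> carrier M" "x' \<in> carrier M" "y \<in> carrier N"
    have "tensor_ker R M N +>\<^bsub>tensor_free\<^esub> basis_elt R (x \<oplus>\<^bsub>M\<^esub> x', y) = tensor_ker R M N +>\<^bsub>tensor_free\<^esub> (basis_elt R (x, y) \<oplus>\<^bsub>tensor_free\<^esub> basis_elt R (x', y))"
      by (rule eq) (use * in \<open>(simp only: tensor_rels_def Let_def, blast) | simp\<close>)+
    then show "tensor R M N (x \<oplus>\<^bsub>M\<^esub> x') y =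
        tensor R M N x y \<oplus>\<^bsub>tensor_module R M N\<^esub> tensor R M N x' y"
      by (simp only: tensor_def linear_mapD(2)[OF tensor_proj_linear] tensor_basis_closed *)
  next
    fix r x y assume *: "r \<in> carrier R" "x \<in> carrier M" "y \<in> carrier N"
    have "tensor_ker R M N +>\<^bsub>tensor_free\<^esub> basis_elt R (r \<odot>\<^bsub>M\<^esub> x, y) = tensor_ker R M N +>\<^bsub>tensor_free\<^esub> (r \<odot>\<^bsub>tensor_free\<^esub> basis_elt R (x, y))"
      by (rule eq) (use * in \<open>(simp only: tensor_rels_def Let_def, blast) | simp\<close>)+
    then show "tensor R M N (r \<odot>\<^bsub>M\<^esub> x) y = r \<odot>\<^bsub>tensor_module R M N\<^esub> tensor R M N x y"
      by (simp only: tensor_def linear_mapD(3)[OF tensor_proj_linear] tensor_basis_closed *)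
    have "tensor_ker R M N +>\<^bsub>tensor_free\<^esub> basis_elt R (x, r \<odot>\<^bsub>N\<^esub> y) = tensor_ker R M N +>\<^bsub>tensor_free\<^esub> (r \<odot>\<^bsub>tensor_free\<^esub> basis_elt R (x, y))"
      by (rule eq) (use * in \<open>(simp only: tensor_rels_def Let_def, blast) | simp\<close>)+
    then show "tensor R M N x (r \<odot>\<^bsub>N\<^esub> y) = r \<odot>\<^bsub>tensor_module R M N\<^esub> tensor R M N x y"
      by (simp only: tensor_def linear_mapD(3)[OF tensor_proj_linear] tensor_basis_closed *)
  qed
qed

lemma tensor_module_carrierE:
  assumes "t \<in> carrier (tensor_module R M N)"
  obtains v where "v \<in> carrier tensor_free" "t = tensor_ker R M N +>\<^bsub>tensor_free\<^esub> v"
  using assms quot_module_sel(1)[OF F.module_axioms tensor_ker_submodule]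
  unfolding tensor_module_def by blast

context
  fixes P :: "('r, 'p, 'l) module_scheme" and \<beta> :: "'m \<Rightarrow> 'n \<Rightarrow> 'p"
  assumes P: "module R P" and \<beta>: "bilinear_map R M N P \<beta>"
begin

interpretation P: module R P by (rule P)

abbreviation (input) "bilinear_ext \<equiv> free_lift R P (\<lambda>(x, y). \<beta> x y)"

lemma bilinear_ext_linear: "linear_map R tensor_free P bilinear_ext"
  using bilinear_map_closed[OF \<beta>] by (intro free_lift_linear[OF P]) auto

lemma bilinear_ext_basis:
  "\<lbrakk>x \<in> carrier M; y \<in> carrier N\<rbrakk> \<Longrightarrow> bilinear_ext (basis_elt R (x, y)) = \<beta> x y"
  using bilinear_map_closed[OF \<beta>] by (subst free_lift_basis[OF P]) auto

text \<open>Bilinearity of \<open>\<beta>\<close> says that the linear extension kills every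
  generator. Its kernel is thus a submodule containing \<open>tensor_rels\<close>, and so contains
  the span.\<close>

lemma bilinear_ext_tensor_ker:
  assumes "t \<in> tensor_ker R M N"
  shows "bilinear_ext t = \<zero>\<^bsub>P\<^esub>"
proof -
  note [simp del] = free_module_sel
  note [simp] = tensor_basis_closed bilinear_ext_basis linear_mapD[OF bilinear_ext_linear]
    linear_map_minus[OF F.module_axioms P bilinear_ext_linear] bilinear_map_closed[OF \<beta>]
  have "bilinear_ext t = \<zero>\<^bsub>P\<^esub>" if "t \<in> tensor_rels R M N" for t
    using that linear_mapD[OF bilinear_mapD(1)[OF \<beta>]] linear_mapD[OF bilinear_mapD(2)[OF \<beta>]]
    by (auto simp: tensor_rels_def Let_def P.M.r_neg P.M.minus_eq)
  then have "tensor_rels R M N \<subseteq> {t \<in> carrier tensor_free. bilinear_ext t = \<zero>\<^bsub>P\<^esub>}"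
    using tensor_rels_closed by blast
  then show ?thesis
    using span_module_least[OF F.module_axioms tensor_rels_closed
        kernel_submodule[OF F.module_axioms P bilinear_ext_linear]] assms
    unfolding tensor_ker_def by blast
qed

lemma tensor_lift_coset:
  assumes "v \<in> carrier tensor_free"
  shows "tensor_lift R P \<beta> (tensor_ker R M N +>\<^bsub>tensor_free\<^esub> v) = bilinear_ext v"
  unfolding tensor_lift_def
  using coset_image[OF F.module_axioms tensor_ker_submodule P bilinear_ext_linear
      bilinear_ext_tensor_ker assms] by simp

lemma tensor_lift_tensor:
  "\<lbrakk>x \<in> carrier M; y \<in> carrier N\<rbrakk> \<Longrightarrow> tensor_lift R P \<beta> (tensor R M N x y) = \<beta> x y"
  unfolding tensor_def using tensor_lift_coset bilinear_ext_basis tensor_basis_closed by simp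

lemma tensor_lift_linear: "linear_map R (tensor_module R M N) P (tensor_lift R P \<beta>)"
proof (rule linear_mapI)
  fix t assume "t \<in> carrier (tensor_module R M N)"
  then obtain v where "v \<in> carrier tensor_free" "t = tensor_ker R M N +>\<^bsub>tensor_free\<^esub> v"
    by (rule tensor_module_carrierE)
  then show "tensor_lift R P \<beta> t \<in> carrier P"
    using linear_mapD(1)[OF bilinear_ext_linear] by (simp add: tensor_lift_coset)
next
  fix t u assume t: "t \<in> carrier (tensor_module R M N)" and u: "u \<in> carrier (tensor_module R M N)"
  obtain v where v: "v \<in> carrier tensor_free" "t = tensor_ker R M N +>\<^bsub>tensor_free\<^esub> v"
    using t by (rule tensor_module_carrierE)
  obtain w where w: "w \<in> carrier tensor_free" "u = tensor_ker R M N +>\<^bsub>tensor_free\<^esub> w"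
    using u by (rule tensor_module_carrierE)
  show "tensor_lift R P \<beta> (t \<oplus>\<^bsub>tensor_module R M N\<^esub> u)
      = tensor_lift R P \<beta> t \<oplus>\<^bsub>P\<^esub> tensor_lift R P \<beta> u"
    using v(1) w(1) unfolding v(2) w(2)
    by (simp only: linear_mapD(2)[OF tensor_proj_linear, symmetric] tensor_lift_coset
        linear_mapD(2)[OF bilinear_ext_linear] F.M.a_closed)
next
  fix r t assume r: "r \<in> carrier R" and t: "t \<in> carrier (tensor_module R M N)"
  obtain v where v: "v \<in> carrier tensor_free" "t = tensor_ker R M N +>\<^bsub>tensor_free\<^esub> v"
    using t by (rule tensor_module_carrierE)
  show "tensor_lift R P \<beta> (r \<odot>\<^bsub>tensor_module R M N\<^esub> t) = r \<odot>\<^bsub>P\<^esub> tensor_lift R P \<beta> t"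
    using r v(1) unfolding v(2)
    by (simp only: linear_mapD(3)[OF tensor_proj_linear, symmetric] tensor_lift_coset
        linear_mapD(3)[OF bilinear_ext_linear] F.smult_closed)
qed

end

end

section \<open>Finite sums of pure tensors\<close>

lemma pair_sum_Nil [simp]: "pair_sum P \<beta> [] = \<zero>\<^bsub>P\<^esub>"
  by (simp add: pair_sum_def)

lemma pair_sum_Cons [simp]: "pair_sum P \<beta> ((x, y) # xs) = \<beta> x y \<oplus>\<^bsub>P\<^esub> pair_sum P \<beta> xs"
  by (simp add: pair_sum_def)

lemma pair_sum_cong:
  "(\<And>x y. (x, y) \<in> set xs \<Longrightarrow> \<beta> x y = \<beta>' x y) \<Longrightarrow> pair_sum P \<beta> xs = pair_sum P \<beta>' xs"
  by (induction xs) auto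

lemma pair_sum_eq_zero:
  assumes "module R P" "\<And>x y. (x, y) \<in> set xs \<Longrightarrow> \<beta> x y = \<zero>\<^bsub>P\<^esub>"
  shows "pair_sum P \<beta> xs = \<zero>\<^bsub>P\<^esub>"
proof -
  interpret module R P by fact
  show ?thesis using assms(2) by (induction xs) auto
qed

lemma pair_sum_closed:
  assumes "module R P" "\<And>x y. (x, y) \<in> set xs \<Longrightarrow> \<beta> x y \<in> carrier P"
  shows "pair_sum P \<beta> xs \<in> carrier P"
proof -
  interpret module R P by fact
  show ?thesis using assms(2) by (induction xs) auto
qed

lemma pair_sum_append:
  assumes "module R P" "\<And>x y. (x, y) \<in> set (xs @ ys) \<Longrightarrow> \<beta> x y \<in> carrier P"
  shows "pair_sum P \<beta> (xs @ ys) = pair_sum P \<beta> xs \<oplus>\<^bsub>P\<^esub> pair_sum P \<beta> ys"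
proof -
  interpret module R P by fact
  have "pair_sum P \<beta> ys \<in> carrier P" using assms by (intro pair_sum_closed) auto
  then show ?thesis
    using assms(2)
  proof (induction xs)
    case (Cons a xs)
    then have "pair_sum P \<beta> xs \<in> carrier P" by (intro pair_sum_closed[OF assms(1)]) auto
    with Cons show ?case by (cases a) (simp add: M.a_assoc)
  qed simp
qed

lemma linear_map_pair_sum:
  assumes "module R P" "module R Q" "linear_map R P Q h"
    and "\<And>x y. (x, y) \<in> set xs \<Longrightarrow> \<beta> x y \<in> carrier P"
  shows "h (pair_sum P \<beta> xs) = pair_sum Q (\<lambda>x y. h (\<beta> x y)) xs"
  using assms(4)
proof (induction xs)
  case Nil
  then show ?case using linear_map_zero[OF assms(1-3)] by simp
next
  case (Cons a xs)
  then have "pair_sum P \<beta> xs \<in> carrier P" by (intro pair_sum_closed[OF assms(1)]) auto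
  with Cons show ?case by (cases a) (simp add: linear_mapD(2)[OF assms(3)])
qed

text \<open>Here the list is fixed and the summand varies with \<open>z\<close>. This gives
  linearity in a parameter that is not one of the two tensor factors.\<close>

lemma pair_sum_linear:
  assumes "module R M" "module R P" "\<And>x y. (x, y) \<in> set xs \<Longrightarrow> linear_map R M P (\<lambda>z. \<beta> z x y)"
  shows "linear_map R M P (\<lambda>z. pair_sum P (\<beta> z) xs)"
  using assms(3)
proof (induction xs)
  case Nil
  then show ?case using linear_map_zero_fun[OF assms(2)] by simp
next
  case (Cons a xs)
  then show ?case by (cases a) (simp add: linear_map_add[OF assms(1,2)])
qed

lemma pair_sum_add:
  assumes "module R P"
    and "\<And>x y. (x, y) \<in> set xs \<Longrightarrow> \<beta> x y \<in> carrier P" "\<And>x y. (x, y) \<in> set xs \<Longrightarrow> \<gamma> x y \<in> carrier P"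
  shows "pair_sum P (\<lambda>x y. \<beta> x y \<oplus>\<^bsub>P\<^esub> \<gamma> x y) xs = pair_sum P \<beta> xs \<oplus>\<^bsub>P\<^esub> pair_sum P \<gamma> xs"
proof -
  interpret P: module R P by fact
  show ?thesis
    using assms(2,3)
  proof (induction xs)
    case (Cons a xs)
    then have "pair_sum P \<beta> xs \<in> carrier P" "pair_sum P \<gamma> xs \<in> carrier P"
      by (auto intro!: pair_sum_closed[OF assms(1)])
    with Cons show ?case by (cases a) (simp add: P.M.a_ac)
  qed simp
qed

context
  fixes R :: "('r, 'k) ring_scheme"
    and M :: "('r, 'm, 'i) module_scheme" and N :: "('r, 'n, 'j) module_scheme"
  assumes M: "module R M" and N: "module R N"
begin

interpretation M: module R M by (rule M)
interpretation N: module R N by (rule N)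
interpretation F: module R "free_module R (carrier M \<times> carrier N)"
  by (rule free_module_module[OF M.R.is_cring])
interpretation T: module R "tensor_module R M N" by (rule tensor_module_module[OF M N])

lemma tensor_lift_pair_sum:
  assumes "module R P" "bilinear_map R M N P \<beta>" "set xs \<subseteq> carrier M \<times> carrier N"
  shows "tensor_lift R P \<beta> (pair_sum (tensor_module R M N) (tensor R M N) xs) = pair_sum P \<beta> xs"
proof -
  have "tensor_lift R P \<beta> (pair_sum (tensor_module R M N) (tensor R M N) xs)
      = pair_sum P (\<lambda>x y. tensor_lift R P \<beta> (tensor R M N x y)) xs"
    using assms(3)
    by (intro linear_map_pair_sum[OF T.module_axioms assms(1) tensor_lift_linear[OF M N assms(1,2)]]
        tensor_closed[OF M N]) auto
  also have "\<dots> = pair_sum P \<beta> xs"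
    using assms(3) by (intro pair_sum_cong tensor_lift_tensor[OF M N assms(1,2)]) auto
  finally show ?thesis .
qed

text \<open>Induction on a representative in the free module. A coefficient is absorbed into the
  left factor, r (x \<otimes> y) = (r x) \<otimes> y, so lists of pairs without coefficients
  suffice.\<close>

lemma tensor_pair_sumE:
  assumes "t \<in> carrier (tensor_module R M N)"
  obtains xs where "set xs \<subseteq> carrier M \<times> carrier N"
    and "t = pair_sum (tensor_module R M N) (tensor R M N) xs"
proof -
  let ?F = "free_module R (carrier M \<times> carrier N)" and ?T = "tensor_module R M N"
  let ?\<pi> = "\<lambda>v. tensor_ker R M N +>\<^bsub>?F\<^esub> v"
  note \<pi> = tensor_proj_linear[OF M N]
  have "v \<in> carrier ?F \<Longrightarrow> \<exists>xs. set xs \<subseteq> carrier M \<times> carrier N \<and> ?\<pi> v = pair_sum ?T (tensor R M N) xs" for v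
  proof (induction v rule: free_module_induct[OF M.R.is_cring, consumes 1, case_names zero add])
    case zero
    show ?case
      using linear_map_zero[OF F.module_axioms T.module_axioms \<pi>] by (intro exI[of _ "[]"]) simp
  next
    case (add v r p)
    obtain x y where p: "p = (x, y)" "x \<in> carrier M" "y \<in> carrier N" using add.hyps by auto
    obtain xs where xs: "set xs \<subseteq> carrier M \<times> carrier N" "?\<pi> v = pair_sum ?T (tensor R M N) xs"
      using add.IH by blast
    note b = tensor_basis_closed[OF M N p(2,3)]
    have "?\<pi> (v \<oplus>\<^bsub>?F\<^esub> r \<odot>\<^bsub>?F\<^esub> basis_elt R p) = ?\<pi> v \<oplus>\<^bsub>?T\<^esub> r \<odot>\<^bsub>?T\<^esub> tensor R M N x y"
      unfolding p(1) tensor_def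
      using add.hyps b by (simp only: linear_mapD[OF \<pi>] F.smult_closed)
    also have "r \<odot>\<^bsub>?T\<^esub> tensor R M N x y = tensor R M N (r \<odot>\<^bsub>M\<^esub> x) y"
      using linear_mapD(3)[OF bilinear_mapD(2)[OF tensor_bilinear[OF M N]]] p add.hyps by simp
    also have "?\<pi> v \<oplus>\<^bsub>?T\<^esub> tensor R M N (r \<odot>\<^bsub>M\<^esub> x) y
        = tensor R M N (r \<odot>\<^bsub>M\<^esub> x) y \<oplus>\<^bsub>?T\<^esub> ?\<pi> v"
      using add.hyps p linear_mapD(1)[OF \<pi>]
      by (intro T.M.a_comm tensor_closed[OF M N] M.smult_closed)
    also have "\<dots> = pair_sum ?T (tensor R M N) ((r \<odot>\<^bsub>M\<^esub> x, y) # xs)"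
      using xs(2) by simp
    finally show ?case
      using xs(1) p add.hyps by (intro exI[of _ "(r \<odot>\<^bsub>M\<^esub> x, y) # xs"]) auto
  qed
  then show ?thesis
    using tensor_module_carrierE[OF M N assms] that by metis
qed

end

section \<open>The convolution ring\<close>

text \<open>The geometric series needs sums, for which the monoid \<open>conv_algebra\<close> has no
  operation. The ring is set up on all of \<open>C\<close>, where a convolution is a linear lift
  from C \<otimes> C applied to \<open>\<Delta> x\<close>.\<close>

definition conv_ring ::
    "('r, 'k) ring_scheme \<Rightarrow> ('r, 'c, 'i) module_scheme \<Rightarrow> ('c \<Rightarrow> ('c \<times> 'c \<Rightarrow> 'r) set) \<Rightarrow> ('c \<Rightarrow> 'r)
      \<Rightarrow> ('r, 'a, 'j) module_scheme \<Rightarrow> ('c \<Rightarrow> 'a) ring"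
  where "conv_ring R C \<Delta> \<epsilon> A =
    \<lparr>carrier = mod_hom R C A, mult = conv R C \<Delta> A (carrier C),
     one = (\<lambda>x\<in>carrier C. unit_map A (\<epsilon> x)),
     zero = (\<lambda>x\<in>carrier C. \<zero>\<^bsub>A\<^esub>), add = (\<lambda>g h. \<lambda>x\<in>carrier C. g x \<oplus>\<^bsub>A\<^esub> h x)\<rparr>"

lemma conv_ring_sel [simp]:
  "carrier (conv_ring R C \<Delta> \<epsilon> A) = mod_hom R C A"
  "mult (conv_ring R C \<Delta> \<epsilon> A) = conv R C \<Delta> A (carrier C)"
  "\<one>\<^bsub>conv_ring R C \<Delta> \<epsilon> A\<^esub> = (\<lambda>x\<in>carrier C. unit_map A (\<epsilon> x))"
  "\<zero>\<^bsub>conv_ring R C \<Delta> \<epsilon> A\<^esub> = (\<lambda>x\<in>carrier C. \<zero>\<^bsub>A\<^esub>)"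
  "add (conv_ring R C \<Delta> \<epsilon> A) = (\<lambda>g h. \<lambda>x\<in>carrier C. g x \<oplus>\<^bsub>A\<^esub> h x)"
  by (simp_all add: conv_ring_def)

text \<open>\<open>Units\<close> reads only the carrier, the product and the unit, and the two
  records share these.\<close>

lemma Units_conv_ring: "Units (conv_algebra R C \<Delta> \<epsilon> A (carrier C)) = Units (conv_ring R C \<Delta> \<epsilon> A)"
  by (simp add: Units_def conv_algebra_def conv_ring_def mod_hom_def)

text \<open>The sources \<open>M\<close> and \<open>N\<close> are kept apart because associativity
  of convolution needs the case where \<open>N\<close> is C \<otimes> C and \<open>g\<close> is
  itself a lift.\<close>

lemma product_bilinear:
  assumes "assoc_algebra R A" "module R M" "module R N" "linear_map R M A f" "linear_map R N A g"
  shows "bilinear_map R M N A (\<lambda>x y. f x \<otimes>\<^bsub>A\<^esub> g y)"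
proof -
  interpret A: assoc_algebra R A by fact
  show ?thesis
    using linear_mapD[OF assms(4)] linear_mapD[OF assms(5)]
    by (intro bilinear_mapI linear_mapI)
       (simp_all add: A.l_distr A.r_distr A.smult_mult_l A.smult_mult_r)
qed

section \<open>Convolution on Hom(C, A) and its ring axioms\<close>

context
  fixes R :: "('r, 'k) ring_scheme"
    and C :: "('r, 'c, 'i) module_scheme"
    and A :: "('r, 'a, 'j) module_scheme"
    and \<Delta> :: "'c \<Rightarrow> ('c \<times> 'c \<Rightarrow> 'r) set"
    and \<epsilon> :: "'c \<Rightarrow> 'r"
  assumes C: "coalgebra R C \<Delta> \<epsilon>" and A: "assoc_algebra R A"
begin

interpretation C: coalgebra R C \<Delta> \<epsilon> by (rule C)
interpretation A: assoc_algebra R A by (rule A)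

lemma CC_module: "module R (tensor_module R C C)"
  by (rule tensor_module_module[OF C.module_axioms C.module_axioms])

lemma comult_linear: "linear_map R C (tensor_module R C C) \<Delta>"
  using C.comult_hom by (auto simp: mod_hom_iff intro: linear_map_cong[OF C.module_axioms])

lemma comultE:
  assumes "x \<in> carrier C"
  obtains xs where "set xs \<subseteq> carrier C \<times> carrier C"
    and "\<Delta> x = pair_sum (tensor_module R C C) (tensor R C C) xs"
  using linear_mapD(1)[OF comult_linear assms] by (rule tensor_pair_sumE[OF C.module_axioms C.module_axioms])


text \<open>The right-hand side does not mention \<open>xs\<close>: this is independence of the
  expression. The list has entries in \<open>S\<close>, but \<open>f\<close> and \<open>g\<close>
  are linear on all of \<open>C\<close>, so the sum can be evaluated by the lift from C \<otimes>
  C.\<close>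

lemma sweedler_pair_sum:
  assumes "linear_map R C A f" "linear_map R C A g" "S \<subseteq> carrier C" "sweedler R C \<Delta> S s xs"
  shows "pair_sum A (\<lambda>x y. f x \<otimes>\<^bsub>A\<^esub> g y) xs = tensor_lift R A (\<lambda>x y. f x \<otimes>\<^bsub>A\<^esub> g y) (\<Delta> s)"
proof -
  have "set xs \<subseteq> carrier C \<times> carrier C" using assms(3,4) by (auto simp: sweedler_def)
  then show ?thesis
    using assms(4) tensor_lift_pair_sum[OF C.module_axioms C.module_axioms A.module_axioms
      product_bilinear[OF A C.module_axioms C.module_axioms assms(1,2)]]
    by (simp add: sweedler_def)
qed

lemma conv_eq_tensor_lift:
  assumes "linear_map R C A f" "linear_map R C A g" "x \<in> carrier C"
  shows "conv R C \<Delta> A (carrier C) f g x = tensor_lift R A (\<lambda>x y. f x \<otimes>\<^bsub>A\<^esub> g y) (\<Delta> x)"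
proof -
  obtain xs where "sweedler R C \<Delta> (carrier C) x xs"
    using comultE[OF assms(3)] unfolding sweedler_def by metis
  then have "sweedler R C \<Delta> (carrier C) x (SOME xs. sweedler R C \<Delta> (carrier C) x xs)"
    by (rule someI)
  from sweedler_pair_sum[OF assms(1,2) subset_refl this] show ?thesis
    using assms(3) by (simp add: conv_def)
qed

lemma conv_eq_pair_sum:
  assumes "linear_map R C A f" "linear_map R C A g" "x \<in> carrier C"
    and "set xs \<subseteq> carrier C \<times> carrier C" "\<Delta> x = pair_sum (tensor_module R C C) (tensor R C C) xs"
  shows "conv R C \<Delta> A (carrier C) f g x = pair_sum A (\<lambda>x y. f x \<otimes>\<^bsub>A\<^esub> g y) xs"
  using conv_eq_tensor_lift[OF assms(1-3)] sweedler_pair_sum[OF assms(1,2) subset_refl, of x xs] assms(4,5)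
  by (simp add: sweedler_def)

text \<open>On the carrier the convolution is the composite of \<open>\<Delta>\<close> with the lift
  of the bilinear map f x g y.\<close>

lemma conv_linear:
  assumes "linear_map R C A f" "linear_map R C A g"
  shows "linear_map R C A (conv R C \<Delta> A (carrier C) f g)"
  using linear_map_cong[OF C.module_axioms linear_map_comp[OF comult_linear tensor_lift_linear[OF C.module_axioms C.module_axioms
      A.module_axioms product_bilinear[OF A C.module_axioms C.module_axioms assms]]]] conv_eq_tensor_lift[OF assms] by metis

lemma conv_mod_hom:
  assumes "f \<in> mod_hom R C A" "g \<in> mod_hom R C A"
  shows "conv R C \<Delta> A (carrier C) f g \<in> mod_hom R C A"
  using assms conv_linear by (auto simp: mod_hom_iff conv_def)

text \<open>The bridge between the two convolution algebras. An expression with entries in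
  \<open>S\<close> is also an expression in C \<otimes> C, so for restrictions of maps on
  \<open>C\<close> the lift computes both sides, even when S \<otimes> S does not embed into C
  \<otimes> C.\<close>

lemma conv_subcoalgebra:
  assumes "linear_map R C A f" "linear_map R C A g" "subcoalgebra R C \<Delta> S"
  shows "conv R C \<Delta> A S (restrict f S) (restrict g S) = restrict (conv R C \<Delta> A (carrier C) f g) S"
proof (rule ext)
  fix s
  have S: "S \<subseteq> carrier C" using assms(3) C.submoduleE(1) by (auto simp: subcoalgebra_def)
  show "conv R C \<Delta> A S (restrict f S) (restrict g S) s = restrict (conv R C \<Delta> A (carrier C) f g) S s"
  proof (cases "s \<in> S")
    case True
    let ?xs = "SOME xs. sweedler R C \<Delta> S s xs"
    \<comment> \<open>Being a subcoalgebra guarantees that some expression has its entries in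
      \<open>S\<close>, so that the choice by \<open>SOME\<close> is a genuine one.\<close>
    have "\<Delta> s \<in> boxtimes R C S S" using assms(3) True by (auto simp: subcoalgebra_def)
    then have "\<exists>xs. sweedler R C \<Delta> S s xs" by (auto simp: boxtimes_def sweedler_def)
    then have xs: "sweedler R C \<Delta> S s ?xs" by (rule someI_ex)
    have "sweedler R C \<Delta> S s ys \<Longrightarrow> set ys \<subseteq> S \<times> S" for ys by (simp add: sweedler_def)
    from this[OF xs] have xs_S: "set ?xs \<subseteq> S \<times> S" .
    have "conv R C \<Delta> A S (restrict f S) (restrict g S) s = pair_sum A (\<lambda>x y. f x \<otimes>\<^bsub>A\<^esub> g y) ?xs"
      unfolding conv_def using True xs_S by (auto intro!: pair_sum_cong)
    then show ?thesis
      using sweedler_pair_sum[OF assms(1,2) S xs] conv_eq_tensor_lift[OF assms(1,2)] S True by auto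
  qed (simp add: conv_def)
qed

text \<open>The linear map \<open>?L\<close>, sending u \<otimes> (v \<otimes> z) to f u (g v h z),
  is applied to both sides of \<open>coassoc\<close>. It turns the left side into the convolution
  bracketed to the left and the right side into the one bracketed to the right. The map
  \<open>?a\<close> is the associator from that axiom.\<close>

lemma conv_assoc:
  assumes f: "linear_map R C A f" and g: "linear_map R C A g" and h: "linear_map R C A h"
    and x: "x \<in> carrier C"
  shows "conv R C \<Delta> A (carrier C) (conv R C \<Delta> A (carrier C) f g) h x
       = conv R C \<Delta> A (carrier C) f (conv R C \<Delta> A (carrier C) g h) x"
proof -
  let ?CC = "tensor_module R C C"
  let ?C_CC = "tensor_module R C ?CC" and ?CC_C = "tensor_module R ?CC C"
  let ?a = "\<lambda>t z. tensor_lift R ?C_CC (\<lambda>u v. tensor R C ?CC u (tensor R C C v z)) t"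
  let ?gh = "tensor_lift R A (\<lambda>u v. g u \<otimes>\<^bsub>A\<^esub> h v)"
  let ?L = "tensor_lift R A (\<lambda>u t. f u \<otimes>\<^bsub>A\<^esub> ?gh t)"
  have C_CC: "module R ?C_CC" and CC_C: "module R ?CC_C"
    by (rule tensor_module_module[OF C.module_axioms CC_module], rule tensor_module_module[OF CC_module C.module_axioms])
  note \<Delta> = comult_linear
  note t1 = tensor_bilinear[OF C.module_axioms C.module_axioms] and t2 = tensor_bilinear[OF C.module_axioms CC_module]
    and t3 = tensor_bilinear[OF CC_module C.module_axioms]
  have bgh: "bilinear_map R C C A (\<lambda>u v. g u \<otimes>\<^bsub>A\<^esub> h v)"
    by (rule product_bilinear[OF A C.module_axioms C.module_axioms g h])
  have lgh: "linear_map R ?CC A ?gh" by (rule tensor_lift_linear[OF C.module_axioms C.module_axioms A.module_axioms bgh])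
  have bL: "bilinear_map R C ?CC A (\<lambda>u t. f u \<otimes>\<^bsub>A\<^esub> ?gh t)"
    by (rule product_bilinear[OF A C.module_axioms CC_module f lgh])
  have L: "linear_map R ?C_CC A ?L" by (rule tensor_lift_linear[OF C.module_axioms CC_module A.module_axioms bL])
  have L_tensor: "?L (tensor R C ?CC u t) = f u \<otimes>\<^bsub>A\<^esub> ?gh t" if "u \<in> carrier C" "t \<in> carrier ?CC" for u t
    by (rule tensor_lift_tensor[OF C.module_axioms CC_module A.module_axioms bL that])
  have b1: "bilinear_map R C C ?C_CC (\<lambda>u v. tensor R C ?CC u (\<Delta> v))"
    by (intro bilinear_mapI linear_map_comp[OF \<Delta> bilinear_mapD(1)[OF t2]] bilinear_mapD(2)[OF t2]
        linear_mapD(1)[OF \<Delta>])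
  have b2: "bilinear_map R C C ?CC_C (\<lambda>u v. tensor R ?CC C (\<Delta> u) v)"
    by (intro bilinear_mapI linear_map_comp[OF \<Delta> bilinear_mapD(2)[OF t3]] bilinear_mapD(1)[OF t3]
        linear_mapD(1)[OF \<Delta>])
  have b3: "bilinear_map R C C ?C_CC (\<lambda>u v. tensor R C ?CC u (tensor R C C v z))" if z: "z \<in> carrier C" for z
    by (intro bilinear_mapI linear_map_comp[OF bilinear_mapD(2)[OF t1 z] bilinear_mapD(1)[OF t2]]
        bilinear_mapD(2)[OF t2] tensor_closed[OF C.module_axioms C.module_axioms] z)
  have b3': "linear_map R C ?C_CC (\<lambda>z. tensor R C ?CC u (tensor R C C v z))"
    if "u \<in> carrier C" "v \<in> carrier C" for u v
    by (rule linear_map_comp[OF bilinear_mapD(1)[OF t1 that(2)] bilinear_mapD(1)[OF t2 that(1)]])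
  have a_sum: "?a (pair_sum ?CC (tensor R C C) ys) z
      = pair_sum ?C_CC (\<lambda>u v. tensor R C ?CC u (tensor R C C v z)) ys"
    if "set ys \<subseteq> carrier C \<times> carrier C" "z \<in> carrier C" for ys z
    by (rule tensor_lift_pair_sum[OF C.module_axioms C.module_axioms C_CC b3[OF that(2)] that(1)])
  \<comment> \<open>For each \<open>z\<close> there is a separate lift, so linearity in
    \<open>t\<close> is automatic but linearity in \<open>z\<close> is not. It is checked after
    writing \<open>t\<close> as a sum of pure tensors.\<close>
  have ba: "bilinear_map R ?CC C ?C_CC ?a"
  proof (rule bilinear_mapI)
    fix z assume "z \<in> carrier C"
    then show "linear_map R ?CC ?C_CC (\<lambda>t. ?a t z)"
      by (intro tensor_lift_linear[OF C.module_axioms C.module_axioms C_CC] b3)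
  next
    fix t assume "t \<in> carrier ?CC"
    then obtain ys where ys: "set ys \<subseteq> carrier C \<times> carrier C" "t = pair_sum ?CC (tensor R C C) ys"
      by (rule tensor_pair_sumE[OF C.module_axioms C.module_axioms])
    have "linear_map R C ?C_CC (\<lambda>z. pair_sum ?C_CC (\<lambda>u v. tensor R C ?CC u (tensor R C C v z)) ys)"
      using ys(1) b3' by (intro pair_sum_linear[OF C.module_axioms C_CC]) auto
    then show "linear_map R C ?C_CC (?a t)"
      unfolding ys(2) by (rule linear_map_cong[OF C.module_axioms]) (simp add: a_sum[OF ys(1)])
  qed
  obtain xs where xs: "set xs \<subseteq> carrier C \<times> carrier C" "\<Delta> x = pair_sum ?CC (tensor R C C) xs"
    using x by (rule comultE)
  \<comment> \<open>Associativity of \<open>A\<close> enters here, term by term over an expression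
    of \<open>\<Delta> u\<close>. Right multiplication by \<open>h v\<close> is linear and can then
    be taken out of the sum.\<close>
  have lhs: "?L (?a (\<Delta> u) v) = conv R C \<Delta> A (carrier C) f g u \<otimes>\<^bsub>A\<^esub> h v"
    if u: "u \<in> carrier C" and v: "v \<in> carrier C" for u v
  proof -
    obtain ys where ys: "set ys \<subseteq> carrier C \<times> carrier C" "\<Delta> u = pair_sum ?CC (tensor R C C) ys"
      using u by (rule comultE)
    have "?L (?a (\<Delta> u) v) = pair_sum A (\<lambda>p q. ?L (tensor R C ?CC p (tensor R C C q v))) ys"
      unfolding ys(2) a_sum[OF ys(1) v] using ys(1) v
      by (intro linear_map_pair_sum[OF C_CC A.module_axioms L] tensor_closed[OF C.module_axioms CC_module]
          tensor_closed[OF C.module_axioms C.module_axioms]) auto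
    also have "\<dots> = pair_sum A (\<lambda>p q. (f p \<otimes>\<^bsub>A\<^esub> g q) \<otimes>\<^bsub>A\<^esub> h v) ys"
    proof (rule pair_sum_cong)
      fix p q assume "(p, q) \<in> set ys"
      then have pq: "p \<in> carrier C" "q \<in> carrier C" using ys(1) by auto
      then show "?L (tensor R C ?CC p (tensor R C C q v)) = (f p \<otimes>\<^bsub>A\<^esub> g q) \<otimes>\<^bsub>A\<^esub> h v"
        using v by (simp add: L_tensor tensor_closed[OF C.module_axioms C.module_axioms] A.m_assoc
            tensor_lift_tensor[OF C.module_axioms C.module_axioms A.module_axioms bgh] linear_mapD(1)[OF f]
            linear_mapD(1)[OF g] linear_mapD(1)[OF h])
    qed
    also have "\<dots> = pair_sum A (\<lambda>p q. f p \<otimes>\<^bsub>A\<^esub> g q) ys \<otimes>\<^bsub>A\<^esub> h v"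
    proof -
      have "linear_map R A A (\<lambda>a. a \<otimes>\<^bsub>A\<^esub> h v)"
        using v linear_mapD(1)[OF h] by (intro linear_mapI) (auto simp: A.l_distr A.smult_mult_l)
      then show ?thesis
        using ys(1) linear_mapD(1)[OF f] linear_mapD(1)[OF g]
        by (intro linear_map_pair_sum[OF A.module_axioms A.module_axioms, symmetric]) auto
    qed
    also have "pair_sum A (\<lambda>p q. f p \<otimes>\<^bsub>A\<^esub> g q) ys = conv R C \<Delta> A (carrier C) f g u"
      by (rule conv_eq_pair_sum[OF f g u ys, symmetric])
    finally show ?thesis .
  qed
  \<comment> \<open>The left side of \<open>coassoc\<close>, expanded over \<open>xs\<close>: each u
    \<otimes> v becomes \<Delta>(u) \<otimes> v and is then rebracketed by
    \<open>?a\<close>.\<close>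
  have "tensor_lift R ?C_CC ?a (tensor_lift R ?CC_C (\<lambda>u v. tensor R ?CC C (\<Delta> u) v) (\<Delta> x))
      = tensor_lift R ?C_CC ?a (pair_sum ?CC_C (\<lambda>u v. tensor R ?CC C (\<Delta> u) v) xs)"
    unfolding xs(2) by (simp only: tensor_lift_pair_sum[OF C.module_axioms C.module_axioms CC_C b2 xs(1)])
  also have "\<dots> = pair_sum ?C_CC (\<lambda>u v. tensor_lift R ?C_CC ?a (tensor R ?CC C (\<Delta> u) v)) xs"
    using xs(1) linear_mapD(1)[OF \<Delta>]
    by (intro linear_map_pair_sum[OF CC_C C_CC tensor_lift_linear[OF CC_module C.module_axioms C_CC ba]]
        tensor_closed[OF CC_module C.module_axioms]) auto
  also have "\<dots> = pair_sum ?C_CC (\<lambda>u v. ?a (\<Delta> u) v) xs"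
    using xs(1) linear_mapD(1)[OF \<Delta>]
    by (intro pair_sum_cong tensor_lift_tensor[OF CC_module C.module_axioms C_CC ba]) auto
  finally have "?L (tensor_lift R ?C_CC ?a (tensor_lift R ?CC_C (\<lambda>u v. tensor R ?CC C (\<Delta> u) v) (\<Delta> x)))
      = pair_sum A (\<lambda>u v. ?L (?a (\<Delta> u) v)) xs"
    using xs(1) linear_mapD(1)[OF \<Delta>] bilinear_map_closed[OF ba]
    by (simp only:) (intro linear_map_pair_sum[OF C_CC A.module_axioms L]; auto)
  also have "\<dots> = pair_sum A (\<lambda>u v. conv R C \<Delta> A (carrier C) f g u \<otimes>\<^bsub>A\<^esub> h v) xs"
    using xs(1) lhs by (intro pair_sum_cong) auto
  also have "\<dots> = conv R C \<Delta> A (carrier C) (conv R C \<Delta> A (carrier C) f g) h x"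
    by (rule conv_eq_pair_sum[OF conv_linear[OF f g] h x xs, symmetric])
  finally have 1: "?L (tensor_lift R ?C_CC ?a (tensor_lift R ?CC_C (\<lambda>u v. tensor R ?CC C (\<Delta> u) v) (\<Delta> x)))
      = conv R C \<Delta> A (carrier C) (conv R C \<Delta> A (carrier C) f g) h x" .
  have "?L (tensor_lift R ?C_CC (\<lambda>u v. tensor R C ?CC u (\<Delta> v)) (\<Delta> x))
      = ?L (pair_sum ?C_CC (\<lambda>u v. tensor R C ?CC u (\<Delta> v)) xs)"
    unfolding xs(2) by (simp only: tensor_lift_pair_sum[OF C.module_axioms C.module_axioms C_CC b1 xs(1)])
  also have "\<dots> = pair_sum A (\<lambda>u v. ?L (tensor R C ?CC u (\<Delta> v))) xs"
    using xs(1) linear_mapD(1)[OF \<Delta>]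
    by (intro linear_map_pair_sum[OF C_CC A.module_axioms L] tensor_closed[OF C.module_axioms CC_module]) auto
  also have "\<dots> = pair_sum A (\<lambda>u v. f u \<otimes>\<^bsub>A\<^esub> conv R C \<Delta> A (carrier C) g h v) xs"
    using xs(1) linear_mapD(1)[OF \<Delta>]
    by (intro pair_sum_cong) (auto simp: L_tensor conv_eq_tensor_lift[OF g h])
  also have "\<dots> = conv R C \<Delta> A (carrier C) f (conv R C \<Delta> A (carrier C) g h) x"
    by (rule conv_eq_pair_sum[OF f conv_linear[OF g h] x xs, symmetric])
  finally show ?thesis
    using 1 C.coassoc[OF x] unfolding Let_def by simp
qed

lemma conv_unit_linear: "linear_map R C A (\<lambda>x\<in>carrier C. unit_map A (\<epsilon> x))"
proof -
  have "linear_map R C A (\<lambda>x. unit_map A (\<epsilon> x))"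
    by (intro linear_mapI)
       (auto simp: unit_map_def C.counit_closed C.counit_add C.counit_smult A.smult_l_distr A.smult_assoc1)
  then show ?thesis by (rule linear_map_cong[OF C.module_axioms]) simp
qed

text \<open>Linearity of \<open>f\<close> moves the scalar inside: \<epsilon>(u) f(v) =
  f(\<epsilon>(u) v). The convolution is therefore \<open>f\<close> applied to the left-hand side of
  \<open>counit_l\<close>.\<close>

lemma conv_unit_left:
  assumes f: "linear_map R C A f" and x: "x \<in> carrier C"
  shows "conv R C \<Delta> A (carrier C) (\<lambda>x\<in>carrier C. unit_map A (\<epsilon> x)) f x = f x"
proof -
  obtain xs where xs: "set xs \<subseteq> carrier C \<times> carrier C"
      "\<Delta> x = pair_sum (tensor_module R C C) (tensor R C C) xs"
    using x by (rule comultE)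
  have b: "bilinear_map R C C C (\<lambda>u v. \<epsilon> u \<odot>\<^bsub>C\<^esub> v)"
    by (intro bilinear_mapI linear_mapI)
       (auto simp: C.counit_closed C.counit_add C.counit_smult C.smult_l_distr C.smult_r_distr C.smult_assoc1
         C.R.m_comm simp flip: C.smult_assoc1)
  have "conv R C \<Delta> A (carrier C) (\<lambda>x\<in>carrier C. unit_map A (\<epsilon> x)) f x
      = pair_sum A (\<lambda>u v. f (\<epsilon> u \<odot>\<^bsub>C\<^esub> v)) xs"
    unfolding conv_eq_pair_sum[OF conv_unit_linear f x xs] using xs(1)
    by (intro pair_sum_cong)
       (auto simp: unit_map_def C.counit_closed A.smult_mult_l linear_mapD[OF f])
  also have "\<dots> = f (pair_sum C (\<lambda>u v. \<epsilon> u \<odot>\<^bsub>C\<^esub> v) xs)"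
    using xs(1) by (intro linear_map_pair_sum[OF C.module_axioms A.module_axioms f, symmetric]) (auto simp: C.counit_closed)
  also have "pair_sum C (\<lambda>u v. \<epsilon> u \<odot>\<^bsub>C\<^esub> v) xs = x"
    using tensor_lift_pair_sum[OF C.module_axioms C.module_axioms C.module_axioms b xs(1)] C.counit_l[OF x] xs(2) by simp
  finally show ?thesis .
qed

lemma conv_unit_right:
  assumes f: "linear_map R C A f" and x: "x \<in> carrier C"
  shows "conv R C \<Delta> A (carrier C) f (\<lambda>x\<in>carrier C. unit_map A (\<epsilon> x)) x = f x"
proof -
  obtain xs where xs: "set xs \<subseteq> carrier C \<times> carrier C"
      "\<Delta> x = pair_sum (tensor_module R C C) (tensor R C C) xs"
    using x by (rule comultE)
  have b: "bilinear_map R C C C (\<lambda>u v. \<epsilon> v \<odot>\<^bsub>C\<^esub> u)"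
    by (intro bilinear_mapI linear_mapI)
       (auto simp: C.counit_closed C.counit_add C.counit_smult C.smult_l_distr C.smult_r_distr C.smult_assoc1
         C.R.m_comm simp flip: C.smult_assoc1)
  have "conv R C \<Delta> A (carrier C) f (\<lambda>x\<in>carrier C. unit_map A (\<epsilon> x)) x
      = pair_sum A (\<lambda>u v. f (\<epsilon> v \<odot>\<^bsub>C\<^esub> u)) xs"
    unfolding conv_eq_pair_sum[OF f conv_unit_linear x xs] using xs(1)
    by (intro pair_sum_cong)
       (auto simp: unit_map_def C.counit_closed A.smult_mult_r linear_mapD[OF f])
  also have "\<dots> = f (pair_sum C (\<lambda>u v. \<epsilon> v \<odot>\<^bsub>C\<^esub> u) xs)"
    using xs(1) by (intro linear_map_pair_sum[OF C.module_axioms A.module_axioms f, symmetric]) (auto simp: C.counit_closed)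
  also have "pair_sum C (\<lambda>u v. \<epsilon> v \<odot>\<^bsub>C\<^esub> u) xs = x"
    using tensor_lift_pair_sum[OF C.module_axioms C.module_axioms C.module_axioms b xs(1)] C.counit_r[OF x] xs(2) by simp
  finally show ?thesis .
qed

text \<open>One expression of \<open>\<Delta> x\<close> serves all three convolutions, which reduces
  additivity to the distributive law of \<open>A\<close> in each term.\<close>

lemma conv_add_left:
  assumes f: "linear_map R C A f" and g: "linear_map R C A g" and h: "linear_map R C A h"
    and x: "x \<in> carrier C"
  shows "conv R C \<Delta> A (carrier C) (\<lambda>x\<in>carrier C. f x \<oplus>\<^bsub>A\<^esub> g x) h x
       = conv R C \<Delta> A (carrier C) f h x \<oplus>\<^bsub>A\<^esub> conv R C \<Delta> A (carrier C) g h x"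
proof -
  obtain xs where xs: "set xs \<subseteq> carrier C \<times> carrier C"
      "\<Delta> x = pair_sum (tensor_module R C C) (tensor R C C) xs"
    using x by (rule comultE)
  have fg: "linear_map R C A (\<lambda>x\<in>carrier C. f x \<oplus>\<^bsub>A\<^esub> g x)"
    by (rule linear_map_cong[OF C.module_axioms linear_map_add[OF C.module_axioms A.module_axioms f g]]) simp
  note cl = linear_mapD(1)[OF f] linear_mapD(1)[OF g] linear_mapD(1)[OF h]
  have "conv R C \<Delta> A (carrier C) (\<lambda>x\<in>carrier C. f x \<oplus>\<^bsub>A\<^esub> g x) h x
      = pair_sum A (\<lambda>u v. f u \<otimes>\<^bsub>A\<^esub> h v \<oplus>\<^bsub>A\<^esub> g u \<otimes>\<^bsub>A\<^esub> h v) xs"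
    unfolding conv_eq_pair_sum[OF fg h x xs] using xs(1)
    by (intro pair_sum_cong) (auto simp: cl A.l_distr)
  also have "\<dots> = conv R C \<Delta> A (carrier C) f h x \<oplus>\<^bsub>A\<^esub> conv R C \<Delta> A (carrier C) g h x"
    unfolding conv_eq_pair_sum[OF f h x xs] conv_eq_pair_sum[OF g h x xs]
    using xs(1) by (intro pair_sum_add[OF A.module_axioms]) (auto simp: cl)
  finally show ?thesis .
qed

lemma conv_add_right:
  assumes f: "linear_map R C A f" and g: "linear_map R C A g" and h: "linear_map R C A h"
    and x: "x \<in> carrier C"
  shows "conv R C \<Delta> A (carrier C) h (\<lambda>x\<in>carrier C. f x \<oplus>\<^bsub>A\<^esub> g x) x
       = conv R C \<Delta> A (carrier C) h f x \<oplus>\<^bsub>A\<^esub> conv R C \<Delta> A (carrier C) h g x"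
proof -
  obtain xs where xs: "set xs \<subseteq> carrier C \<times> carrier C"
      "\<Delta> x = pair_sum (tensor_module R C C) (tensor R C C) xs"
    using x by (rule comultE)
  have fg: "linear_map R C A (\<lambda>x\<in>carrier C. f x \<oplus>\<^bsub>A\<^esub> g x)"
    by (rule linear_map_cong[OF C.module_axioms linear_map_add[OF C.module_axioms A.module_axioms f g]]) simp
  note cl = linear_mapD(1)[OF f] linear_mapD(1)[OF g] linear_mapD(1)[OF h]
  have "conv R C \<Delta> A (carrier C) h (\<lambda>x\<in>carrier C. f x \<oplus>\<^bsub>A\<^esub> g x) x
      = pair_sum A (\<lambda>u v. h u \<otimes>\<^bsub>A\<^esub> f v \<oplus>\<^bsub>A\<^esub> h u \<otimes>\<^bsub>A\<^esub> g v) xs"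
    unfolding conv_eq_pair_sum[OF h fg x xs] using xs(1)
    by (intro pair_sum_cong) (auto simp: cl A.r_distr)
  also have "\<dots> = conv R C \<Delta> A (carrier C) h f x \<oplus>\<^bsub>A\<^esub> conv R C \<Delta> A (carrier C) h g x"
    unfolding conv_eq_pair_sum[OF h f x xs] conv_eq_pair_sum[OF h g x xs]
    using xs(1) by (intro pair_sum_add[OF A.module_axioms]) (auto simp: cl)
  finally show ?thesis .
qed

lemma conv_ring_abelian_group: "abelian_group (conv_ring R C \<Delta> \<epsilon> A)"
proof -
  let ?H = "conv_ring R C \<Delta> \<epsilon> A"
  have add: "f \<oplus>\<^bsub>?H\<^esub> g \<in> carrier ?H" if "f \<in> carrier ?H" "g \<in> carrier ?H" for f g
    using that linear_map_add[OF C.module_axioms A.module_axioms, of f g]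
    by (simp add: mod_hom_iff[of f] mod_hom_iff[of g] restrict_mod_hom[OF C.module_axioms])
  have zero: "\<zero>\<^bsub>?H\<^esub> \<in> carrier ?H"
    using restrict_mod_hom[OF C.module_axioms linear_map_zero_fun[OF A.module_axioms]] by simp
  have cl: "f x \<in> carrier A" if "f \<in> mod_hom R C A" "x \<in> carrier C" for f x
    using that by (auto simp: mod_hom_iff linear_map_def)
  show ?thesis
  proof (rule abelian_groupI; (intro add zero; assumption)?)
    fix f g h assume "f \<in> carrier ?H" "g \<in> carrier ?H" "h \<in> carrier ?H"
    then show "f \<oplus>\<^bsub>?H\<^esub> g \<oplus>\<^bsub>?H\<^esub> h = f \<oplus>\<^bsub>?H\<^esub> (g \<oplus>\<^bsub>?H\<^esub> h)"
      by (simp add: fun_eq_iff restrict_def cl A.a_assoc)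
  next
    fix f g assume "f \<in> carrier ?H" "g \<in> carrier ?H"
    then show "f \<oplus>\<^bsub>?H\<^esub> g = g \<oplus>\<^bsub>?H\<^esub> f"
      by (simp add: fun_eq_iff restrict_def cl A.a_comm)
  next
    fix f assume f: "f \<in> carrier ?H"
    then have fl: "linear_map R C A f" by (simp add: mod_hom_iff)
    show "\<zero>\<^bsub>?H\<^esub> \<oplus>\<^bsub>?H\<^esub> f = f"
    proof (rule mod_hom_eqI)
      show "\<zero>\<^bsub>?H\<^esub> \<oplus>\<^bsub>?H\<^esub> f \<in> mod_hom R C A" "f \<in> mod_hom R C A"
        using add[OF zero f] f by simp_all
      show "(\<zero>\<^bsub>?H\<^esub> \<oplus>\<^bsub>?H\<^esub> f) x = f x" if "x \<in> carrier C" for x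
        using f that by (simp add: cl)
    qed
    \<comment> \<open>The negative is written as the scalar multiple by -1 so that its linearity
      follows from \<open>linear_map_smult\<close>.\<close>
    let ?g = "\<lambda>x\<in>carrier C. (\<ominus>\<^bsub>R\<^esub> \<one>\<^bsub>R\<^esub>) \<odot>\<^bsub>A\<^esub> f x"
    have "?g \<in> carrier ?H"
      using restrict_mod_hom[OF C.module_axioms linear_map_smult[OF C.module_axioms A.module_axioms fl]] by simp
    moreover have "?g \<oplus>\<^bsub>?H\<^esub> f = \<zero>\<^bsub>?H\<^esub>"
      using f by (simp add: fun_eq_iff restrict_def cl A.smult_l_minus A.l_neg)
    ultimately show "\<exists>g\<in>carrier ?H. g \<oplus>\<^bsub>?H\<^esub> f = \<zero>\<^bsub>?H\<^esub>" by blast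
  qed
qed

lemma conv_ring_ring: "ring (conv_ring R C \<Delta> \<epsilon> A)"
proof -
  let ?H = "conv_ring R C \<Delta> \<epsilon> A"
  interpret H: abelian_group ?H by (rule conv_ring_abelian_group)
  have one: "\<one>\<^bsub>?H\<^esub> \<in> carrier ?H"
    using conv_unit_linear by (simp add: mod_hom_iff)
  have mult: "f \<otimes>\<^bsub>?H\<^esub> g \<in> carrier ?H" if "f \<in> carrier ?H" "g \<in> carrier ?H" for f g
    using that conv_mod_hom by simp
  show ?thesis
  proof (rule ringI[OF H.abelian_group_axioms])
    show "monoid ?H"
    proof (rule monoidI)
      fix f g h assume *: "f \<in> carrier ?H" "g \<in> carrier ?H" "h \<in> carrier ?H"
      have "f \<otimes>\<^bsub>?H\<^esub> g \<otimes>\<^bsub>?H\<^esub> h \<in> mod_hom R C A" "f \<otimes>\<^bsub>?H\<^esub> (g \<otimes>\<^bsub>?H\<^esub> h) \<in> mod_hom R C A"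
        using mult * by simp_all
      then show "f \<otimes>\<^bsub>?H\<^esub> g \<otimes>\<^bsub>?H\<^esub> h = f \<otimes>\<^bsub>?H\<^esub> (g \<otimes>\<^bsub>?H\<^esub> h)"
        by (rule mod_hom_eqI) (use * in \<open>simp add: conv_assoc mod_hom_linear\<close>)
    next
      fix f assume f: "f \<in> carrier ?H"
      have "\<one>\<^bsub>?H\<^esub> \<otimes>\<^bsub>?H\<^esub> f \<in> mod_hom R C A" "f \<otimes>\<^bsub>?H\<^esub> \<one>\<^bsub>?H\<^esub> \<in> mod_hom R C A" "f \<in> mod_hom R C A"
        using mult one f by simp_all
      then show "\<one>\<^bsub>?H\<^esub> \<otimes>\<^bsub>?H\<^esub> f = f" "f \<otimes>\<^bsub>?H\<^esub> \<one>\<^bsub>?H\<^esub> = f"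
        by (auto intro!: mod_hom_eqI[of _ R C A f] simp: conv_unit_left conv_unit_right mod_hom_linear)
    qed (use one mult in auto)
  next
    fix f g h assume *: "f \<in> carrier ?H" "g \<in> carrier ?H" "h \<in> carrier ?H"
    have "(f \<oplus>\<^bsub>?H\<^esub> g) \<otimes>\<^bsub>?H\<^esub> h \<in> mod_hom R C A" "f \<otimes>\<^bsub>?H\<^esub> h \<oplus>\<^bsub>?H\<^esub> g \<otimes>\<^bsub>?H\<^esub> h \<in> mod_hom R C A"
      using mult H.a_closed * by (metis conv_ring_sel(1))+
    then show "(f \<oplus>\<^bsub>?H\<^esub> g) \<otimes>\<^bsub>?H\<^esub> h = f \<otimes>\<^bsub>?H\<^esub> h \<oplus>\<^bsub>?H\<^esub> g \<otimes>\<^bsub>?H\<^esub> h"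
      by (rule mod_hom_eqI) (use * in \<open>simp add: conv_add_left mod_hom_linear\<close>)
    have "h \<otimes>\<^bsub>?H\<^esub> (f \<oplus>\<^bsub>?H\<^esub> g) \<in> mod_hom R C A" "h \<otimes>\<^bsub>?H\<^esub> f \<oplus>\<^bsub>?H\<^esub> h \<otimes>\<^bsub>?H\<^esub> g \<in> mod_hom R C A"
      using mult H.a_closed * by (metis conv_ring_sel(1))+
    then show "h \<otimes>\<^bsub>?H\<^esub> (f \<oplus>\<^bsub>?H\<^esub> g) = h \<otimes>\<^bsub>?H\<^esub> f \<oplus>\<^bsub>?H\<^esub> h \<otimes>\<^bsub>?H\<^esub> g"
      by (rule mod_hom_eqI) (use * in \<open>simp add: conv_add_right mod_hom_linear\<close>)
  qed
qed

end

section \<open>Extending linear maps\<close>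

text \<open>The coset of \<open>\<phi>\<close> is an element of \<open>Ext1\<close>, hence equals
  its zero, which is the set of coboundaries itself. It contains 0 + \<phi> = \<phi>, because the
  zero map on the first free module has zero coboundary.\<close>

lemma ext1_cocycle_is_coboundary:
  assumes R: "cring R" and N: "module R N"
    and Ext: "carrier (Ext1 R M N) = {\<zero>\<^bsub>Ext1 R M N\<^esub>}"
    and \<phi>: "\<phi> \<in> ext1_cocycles R M N"
  shows "\<phi> \<in> ext1_coboundaries R M N"
proof -
  interpret N: module R N by (rule N)
  let ?Z = "(hom_module R (res1 R M) N)\<lparr>carrier := ext1_cocycles R M N\<rparr>"
  let ?B = "ext1_coboundaries R M N"
  let ?z = "\<lambda>v\<in>carrier (res1 R M). \<zero>\<^bsub>N\<^esub>"
  have P0: "module R (res0 R M)"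
    unfolding free_cover_def by (rule free_module_module[OF R])
  have d1: "res_d1 R M v \<in> carrier (res0 R M)" if "v \<in> carrier (res1 R M)" for v
  proof -
    have "id \<in> carrier (syzygy R M) \<rightarrow> carrier (res0 R M)" by (auto simp: syzygy_def)
    from linear_mapD(1)[OF free_lift_linear[OF P0 this]] that show ?thesis
      by (simp add: res_d1_def free_cover_def)
  qed
  have "restrict (\<lambda>v. \<zero>\<^bsub>N\<^esub>) (carrier (res0 R M)) \<in> mod_hom R (res0 R M) N"
    by (rule restrict_mod_hom[OF P0 linear_map_zero_fun[OF N]])
  moreover have "?z = (\<lambda>v\<in>carrier (res1 R M). restrict (\<lambda>v. \<zero>\<^bsub>N\<^esub>) (carrier (res0 R M)) (res_d1 R M v))"
    using d1 by (auto simp: fun_eq_iff)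
  ultimately have "?z \<in> ?B" unfolding ext1_coboundaries_def by blast
  then have "?z \<oplus>\<^bsub>?Z\<^esub> \<phi> \<in> ?B +>\<^bsub>?Z\<^esub> \<phi>" unfolding a_r_coset_def r_coset_def by auto
  moreover have "?z \<oplus>\<^bsub>?Z\<^esub> \<phi> = \<phi>"
  proof
    fix v
    have "\<phi> \<in> mod_hom R (res1 R M) N" using \<phi> by (simp add: ext1_cocycles_def)
    then show "(?z \<oplus>\<^bsub>?Z\<^esub> \<phi>) v = \<phi> v"
      by (auto simp: hom_module_def mod_hom_iff linear_map_def extensional_def)
  qed
  moreover have "?B +>\<^bsub>?Z\<^esub> \<phi> = ?B"
  proof -
    have "?B +>\<^bsub>?Z\<^esub> \<phi> \<in> carrier (Ext1 R M N)"
      using \<phi> by (auto simp: Ext1_def quot_module_def A_RCOSETS_def')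
    then show ?thesis unfolding Ext by (simp add: Ext1_def quot_module_def)
  qed
  ultimately show ?thesis by simp
qed

text \<open>Used to compare two decompositions of the same element. In \<open>C\<close> it turns an
  equality of sums into one of differences, and in \<open>A\<close> it turns the resulting equality
  back.\<close>

lemma (in abelian_group) add_eq_add_iff:
  assumes "a \<in> carrier G" "b \<in> carrier G" "c \<in> carrier G" "d \<in> carrier G"
  shows "a \<oplus> b = c \<oplus> d \<longleftrightarrow> a \<ominus> c = d \<ominus> b"
proof -
  have "a \<ominus> c = d \<ominus> b \<longleftrightarrow> a \<ominus> c \<oplus> (b \<oplus> c) = d \<ominus> b \<oplus> (b \<oplus> c)"
    using assms by simp
  also have "a \<ominus> c \<oplus> (b \<oplus> c) = a \<oplus> b \<oplus> (c \<ominus> c)" using assms by (simp add: minus_eq a_ac)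
  also have "\<dots> = a \<oplus> b" using assms by (simp add: minus_eq r_neg)
  also have "d \<ominus> b \<oplus> (b \<oplus> c) = c \<oplus> d \<oplus> (b \<ominus> b)" using assms by (simp add: minus_eq a_ac)
  also have "\<dots> = c \<oplus> d" using assms by (simp add: minus_eq r_neg)
  finally show ?thesis by simp
qed

lemma free_lift_zero:
  assumes "module R M" "v \<in> carrier (free_module R X)" "\<And>x. x \<in> X \<Longrightarrow> \<phi> x = \<zero>\<^bsub>M\<^esub>"
  shows "free_lift R M \<phi> v = \<zero>\<^bsub>M\<^esub>"
proof -
  interpret module R M by fact
  have "free_lift R M \<phi> v = free_lift R M (\<lambda>x. \<zero>\<^bsub>M\<^esub>) v"
    using assms(3) by (intro free_lift_cong[OF assms(1) _ _ assms(2)]) auto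
  also have "\<dots> = \<zero>\<^bsub>M\<^esub>"
    by (rule linear_map_free_lift[OF assms(1,1) linear_map_zero_fun[OF assms(1)] _ assms(2), symmetric]) auto
  finally show ?thesis .
qed

text \<open>Stated for an arbitrary module so that it can be applied again to a syzygy when the
  second syzygy is needed.\<close>

lemma syzygy_module:
  assumes "cring R" "module R M"
  shows "module R (syzygy R M)"
    and "linear_map R (syzygy R M) (free_cover R M) id"
    and "v \<in> carrier (syzygy R M) \<longleftrightarrow> v \<in> carrier (free_cover R M) \<and> free_lift R M id v = \<zero>\<^bsub>M\<^esub>"
proof -
  have F: "module R (free_cover R M)"
    unfolding free_cover_def by (rule free_module_module[OF assms(1)])
  have "linear_map R (free_cover R M) M (free_lift R M id)"
    unfolding free_cover_def by (rule free_lift_linear[OF assms(2)]) simp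
  from submodule.submodule_is_module[OF kernel_submodule[OF F assms(2) this] F]
  show "module R (syzygy R M)" by (simp add: syzygy_def)
qed (simp_all add: syzygy_def linear_map_def)

text \<open>
  Lift every element of \<open>C/S\<close> to \<open>C\<close>; this defines \<open>\<Psi> : P\<^sub>0 \<rightarrow> C\<close> mapping the syzygy of \<open>C/S\<close> into \<open>S\<close>.
  The map \<open>g \<circ> \<Psi>\<close> on the syzygy is a cocycle, hence it extends to some \<open>\<psi>\<close> on \<open>P\<^sub>0\<close>. Every
  element of \<open>C\<close> is of the form \<open>\<Psi> v + s\<close>, and \<open>\<Psi> v + s \<mapsto> \<psi> v + g s\<close> is the extension of \<open>g\<close>.
\<close>

lemma ext1_extension:
  assumes C: "module R C" and A: "module R A" and S: "submodule S R C"
    and Ext: "carrier (Ext1 R (quot_module C S) A) = {\<zero>\<^bsub>Ext1 R (quot_module C S) A\<^esub>}"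
    and g: "linear_map R (C\<lparr>carrier := S\<rparr>) A g"
  obtains G where "linear_map R C A G" "\<And>x. x \<in> S \<Longrightarrow> G x = g x"
proof -
  interpret C: module R C by (rule C)
  interpret A: module R A by (rule A)
  have cr: "cring R" by unfold_locales
  let ?M = "quot_module C S"
  let ?K = "syzygy R ?M" and ?P0 = "free_module R (carrier ?M)"
  let ?P1 = "free_module R (carrier ?K)"
  let ?p = "\<lambda>x. S +>\<^bsub>C\<^esub> x"
  have M: "module R ?M" by (rule quot_module_module[OF C S])
  interpret M: module R ?M by (rule M)
  have p: "linear_map R C ?M ?p" by (rule quot_proj_linear[OF C S])
  have P0: "module R ?P0" by (rule free_module_module[OF cr])
  interpret P0: module R ?P0 by (rule P0)
  have P1: "module R ?P1" by (rule free_module_module[OF cr])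
  note K = syzygy_module[OF cr M, unfolded free_cover_def]
  have SC: "S \<subseteq> carrier C" using C.submoduleE(1)[OF S] .
  have S_closed: "s \<oplus>\<^bsub>C\<^esub> t \<in> S" "s \<ominus>\<^bsub>C\<^esub> t \<in> S" if "s \<in> S" "t \<in> S" for s t
    using that C.submoduleE[OF S] by (auto simp: a_minus_def)
  have g_add: "g (s \<oplus>\<^bsub>C\<^esub> t) = g s \<oplus>\<^bsub>A\<^esub> g t" if "s \<in> S" "t \<in> S" for s t
    using linear_mapD(2)[OF g] that by simp
  have g_smult: "g (r \<odot>\<^bsub>C\<^esub> s) = r \<odot>\<^bsub>A\<^esub> g s" if "r \<in> carrier R" "s \<in> S" for r s
    using linear_mapD(3)[OF g] that by simp
  have g_closed: "g s \<in> carrier A" if "s \<in> S" for s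
    using linear_mapD(1)[OF g] that by simp
  \<comment> \<open>A mere choice of representatives, in general not linear. Freeness of
    \<open>?P0\<close> on the carrier of C/S makes a linear map \<open>\<Psi>\<close> out of
    it.\<close>
  define \<sigma> where "\<sigma> X = (SOME x. x \<in> carrier C \<and> X = ?p x)" for X
  have \<sigma>: "\<sigma> X \<in> carrier C" "?p (\<sigma> X) = X" if "X \<in> carrier ?M" for X
  proof -
    have "\<exists>x. x \<in> carrier C \<and> X = ?p x" using that quot_module_sel(1)[OF C S] by auto
    then show "\<sigma> X \<in> carrier C" "?p (\<sigma> X) = X" unfolding \<sigma>_def by (rule someI2_ex; simp)+
  qed
  then have \<sigma>_Pi: "\<sigma> \<in> carrier ?M \<rightarrow> carrier C" by blast
  define \<Psi> where "\<Psi> = free_lift R C \<sigma>"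
  have \<Psi>: "linear_map R ?P0 C \<Psi>" unfolding \<Psi>_def by (rule free_lift_linear[OF C \<sigma>_Pi])
  \<comment> \<open>Since \<open>\<sigma>\<close> picks representatives, \<open>\<Psi>\<close>
    followed by the projection is the augmentation of the resolution. Its kernel \<open>?K\<close>
    is therefore the preimage of \<open>S\<close> under \<open>\<Psi>\<close>.\<close>
  have p\<Psi>: "?p (\<Psi> v) = free_lift R ?M id v" if "v \<in> carrier ?P0" for v
    unfolding \<Psi>_def linear_map_free_lift[OF C M p \<sigma>_Pi that]
    by (rule free_lift_cong[OF M _ _ that]) (use \<sigma> in auto)
  have K_iff: "v \<in> carrier ?K \<longleftrightarrow> \<Psi> v \<in> S" if v: "v \<in> carrier ?P0" for v
  proof -
    have "v \<in> carrier ?K \<longleftrightarrow> ?p (\<Psi> v) = ?p \<zero>\<^bsub>C\<^esub>"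
      using v K(3) p\<Psi> quot_module_sel(2)[OF C S] SC by simp
    moreover have minus_zero: "\<ominus>\<^bsub>C\<^esub> \<zero>\<^bsub>C\<^esub> = \<zero>\<^bsub>C\<^esub>"
      by (metis C.M.r_neg C.M.l_zero C.M.a_inv_closed C.M.zero_closed)
    ultimately show ?thesis
      using coset_eq_iff[OF C S, of "\<Psi> v" "\<zero>\<^bsub>C\<^esub>"] linear_mapD(1)[OF \<Psi> v] minus_zero
      by (simp add: C.M.minus_eq)
  qed
  have K_P0: "v \<in> carrier ?P0" if "v \<in> carrier ?K" for v using that K(3) by blast
  have \<zeta>: "linear_map R ?K A (\<lambda>k. g (\<Psi> k))"
  proof (rule linear_map_comp[OF _ g])
    show "linear_map R ?K (C\<lparr>carrier := S\<rparr>) \<Psi>"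
      using linear_map_comp[OF K(2) \<Psi>] K_iff K_P0 by (auto simp: linear_map_def)
  qed
  then have \<zeta>_Pi: "(\<lambda>k. g (\<Psi> k)) \<in> carrier ?K \<rightarrow> carrier A" by (auto simp: linear_map_def)
  define \<phi> where "\<phi> = free_lift R A (\<lambda>k. g (\<Psi> k))"
  have \<phi>: "linear_map R ?P1 A \<phi>" unfolding \<phi>_def by (rule free_lift_linear[OF A \<zeta>_Pi])
  \<comment> \<open>By linearity \<open>\<phi>\<close> is the canonical map from \<open>?P1\<close>
    to \<open>?K\<close> followed by g \<circ> \<Psi>, so it kills the second syzygy, the kernel of
    that canonical map. The image of \<open>res_d2\<close> consists of combinations of elements of
    the second syzygy.\<close>
  have "restrict \<phi> (carrier ?P1) \<in> ext1_cocycles R ?M A"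
  proof -
    have "\<phi> (res_d2 R ?M w) = \<zero>\<^bsub>A\<^esub> \<and> res_d2 R ?M w \<in> carrier ?P1" if "w \<in> carrier (res2 R ?M)" for w
    proof -
      let ?K2 = "syzygy R ?K"
      note K2 = syzygy_module[OF cr K(1), unfolded free_cover_def]
      have w: "w \<in> carrier (free_module R (carrier ?K2))" using that by (simp add: free_cover_def)
      have id: "id \<in> carrier ?K2 \<rightarrow> carrier ?P1" using K2(3) by auto
      have vanish: "\<phi> (id v) = \<zero>\<^bsub>A\<^esub>" if v: "v \<in> carrier ?K2" for v
      proof -
        have "v \<in> carrier ?P1" "free_lift R ?K id v = \<zero>\<^bsub>?K\<^esub>" using v K2(3) by auto
        then have "\<phi> v = g (\<Psi> \<zero>\<^bsub>?K\<^esub>)"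
          using linear_map_free_lift[OF K(1) A \<zeta>, of id "carrier ?K" v] by (simp add: \<phi>_def)
        also have "\<dots> = \<zero>\<^bsub>A\<^esub>" by (rule linear_map_zero[OF K(1) A \<zeta>])
        finally show ?thesis by simp
      qed
      have "\<phi> (free_lift R ?P1 id w) = free_lift R A (\<lambda>v. \<phi> (id v)) w"
        by (rule linear_map_free_lift[OF P1 A \<phi> id w])
      also have "\<dots> = \<zero>\<^bsub>A\<^esub>" by (rule free_lift_zero[OF A w vanish])
      finally show ?thesis
        using linear_mapD(1)[OF free_lift_linear[OF P1 id] w] by (simp add: res_d2_def free_cover_def)
    qed
    then show ?thesis
      unfolding ext1_cocycles_def using restrict_mod_hom[OF P1 \<phi>] by (simp add: free_cover_def)
  qed
  then have "restrict \<phi> (carrier ?P1) \<in> ext1_coboundaries R ?M A"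
    by (rule ext1_cocycle_is_coboundary[OF cr A Ext])
  then obtain \<psi> where \<psi>: "linear_map R ?P0 A \<psi>"
      and eq: "restrict \<phi> (carrier ?P1) = (\<lambda>v\<in>carrier ?P1. \<psi> (res_d1 R ?M v))"
    unfolding ext1_coboundaries_def by (auto simp: mod_hom_iff free_cover_def)
  \<comment> \<open>The coboundary equation is read at the basis element of \<open>k\<close>, which
    \<open>res_d1\<close> sends to \<open>k\<close> itself. Hence \<open>\<psi>\<close> extends g
    \<circ> \<Psi> from the syzygy to the whole of \<open>?P0\<close>.\<close>
  have key: "\<psi> k = g (\<Psi> k)" if k: "k \<in> carrier ?K" for k
  proof -
    have e: "basis_elt R k \<in> carrier ?P1" by (rule basis_elt_closed[OF cr k])
    have "\<phi> (basis_elt R k) = \<psi> (res_d1 R ?M (basis_elt R k))"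
      using fun_cong[OF eq, of "basis_elt R k"] e by simp
    moreover have "\<phi> (basis_elt R k) = g (\<Psi> k)"
      unfolding \<phi>_def using \<zeta>_Pi k by (intro free_lift_basis[OF A]) auto
    moreover have "res_d1 R ?M (basis_elt R k) = k"
      using free_lift_basis[OF P0, of id k] K_P0[OF k] by (simp add: res_d1_def free_cover_def)
    ultimately show ?thesis by simp
  qed
  \<comment> \<open>Two decompositions of one element differ by v - w, and \<Psi>(v - w) = t - s
    lies in \<open>S\<close>. So v - w is in the syzygy, where \<open>key\<close> compares
    \<open>\<psi>\<close> with \<open>g\<close>.\<close>
  have well_defined: "\<psi> v \<oplus>\<^bsub>A\<^esub> g s = \<psi> w \<oplus>\<^bsub>A\<^esub> g t"
    if eq: "\<Psi> v \<oplus>\<^bsub>C\<^esub> s = \<Psi> w \<oplus>\<^bsub>C\<^esub> t" and v: "v \<in> carrier ?P0" and w: "w \<in> carrier ?P0"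
      and s: "s \<in> S" and t: "t \<in> S" for v w s t
  proof -
    have vw: "v \<ominus>\<^bsub>?P0\<^esub> w \<in> carrier ?P0" using v w by (rule P0.M.minus_closed)
    have st: "s \<in> carrier C" "t \<in> carrier C" using s t SC by auto
    have \<Psi>_eq: "\<Psi> (v \<ominus>\<^bsub>?P0\<^esub> w) = t \<ominus>\<^bsub>C\<^esub> s"
      using eq C.M.add_eq_add_iff linear_mapD(1)[OF \<Psi>] v w st linear_map_minus[OF P0 C \<Psi> v w] by simp
    then have "v \<ominus>\<^bsub>?P0\<^esub> w \<in> carrier ?K" using K_iff[OF vw] S_closed(2)[OF t s] by simp
    from key[OF this] have "\<psi> v \<ominus>\<^bsub>A\<^esub> \<psi> w = g (t \<ominus>\<^bsub>C\<^esub> s)"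
      using \<Psi>_eq linear_map_minus[OF P0 A \<psi> v w] by simp
    moreover have "g (t \<ominus>\<^bsub>C\<^esub> s) \<oplus>\<^bsub>A\<^esub> g s = g t"
      using g_add[OF S_closed(2)[OF t s] s] st by (simp add: C.M.minus_eq C.M.a_assoc C.M.l_neg)
    then have "g (t \<ominus>\<^bsub>C\<^esub> s) = g t \<ominus>\<^bsub>A\<^esub> g s"
      using g_closed s t S_closed(2)[OF t s] by (metis A.M.add.inv_solve_right' A.M.minus_eq)
    ultimately show ?thesis
      using A.M.add_eq_add_iff[of "\<psi> v" "g s" "\<psi> w" "g t"] linear_mapD(1)[OF \<psi>] v w g_closed s t by simp
  qed
  \<comment> \<open>The vector is the basis element of the coset of \<open>x\<close>. It maps to the
    chosen representative of that coset, which differs from \<open>x\<close> by an element of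
    \<open>S\<close>.\<close>
  have decomp: "\<exists>v s. v \<in> carrier ?P0 \<and> s \<in> S \<and> x = \<Psi> v \<oplus>\<^bsub>C\<^esub> s" if x: "x \<in> carrier C" for x
  proof (intro exI conjI)
    have X: "?p x \<in> carrier ?M" using linear_mapD(1)[OF p x] .
    show "basis_elt R (?p x) \<in> carrier ?P0" by (rule basis_elt_closed[OF cr X])
    show "x \<ominus>\<^bsub>C\<^esub> \<sigma> (?p x) \<in> S" using coset_eq_iff[OF C S x \<sigma>(1)[OF X]] \<sigma>(2)[OF X] by simp
    have "\<Psi> (basis_elt R (?p x)) = \<sigma> (?p x)"
      unfolding \<Psi>_def by (rule free_lift_basis[OF C]) (rule \<sigma>(1)[OF X])
    then show "x = \<Psi> (basis_elt R (?p x)) \<oplus>\<^bsub>C\<^esub> (x \<ominus>\<^bsub>C\<^esub> \<sigma> (?p x))"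
      using \<sigma>(1)[OF X] x by (simp add: C.M.minus_eq C.M.a_lcomm C.M.r_neg)
  qed
  define G where "G x = (SOME a. \<exists>v s. v \<in> carrier ?P0 \<and> s \<in> S \<and> x = \<Psi> v \<oplus>\<^bsub>C\<^esub> s \<and> a = \<psi> v \<oplus>\<^bsub>A\<^esub> g s)" for x
  have G: "G (\<Psi> v \<oplus>\<^bsub>C\<^esub> s) = \<psi> v \<oplus>\<^bsub>A\<^esub> g s" if "v \<in> carrier ?P0" "s \<in> S" for v s
    unfolding G_def
  proof (rule some_equality)
    show "\<exists>v' s'. v' \<in> carrier ?P0 \<and> s' \<in> S \<and> \<Psi> v \<oplus>\<^bsub>C\<^esub> s = \<Psi> v' \<oplus>\<^bsub>C\<^esub> s'
        \<and> \<psi> v \<oplus>\<^bsub>A\<^esub> g s = \<psi> v' \<oplus>\<^bsub>A\<^esub> g s'"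
      using that by blast
  next
    fix a assume "\<exists>v' s'. v' \<in> carrier ?P0 \<and> s' \<in> S \<and> \<Psi> v \<oplus>\<^bsub>C\<^esub> s = \<Psi> v' \<oplus>\<^bsub>C\<^esub> s'
        \<and> a = \<psi> v' \<oplus>\<^bsub>A\<^esub> g s'"
    then obtain v' s' where *: "v' \<in> carrier ?P0" "s' \<in> S" "\<Psi> v \<oplus>\<^bsub>C\<^esub> s = \<Psi> v' \<oplus>\<^bsub>C\<^esub> s'"
      "a = \<psi> v' \<oplus>\<^bsub>A\<^esub> g s'" by blast
    show "a = \<psi> v \<oplus>\<^bsub>A\<^esub> g s"
      unfolding *(4) by (rule well_defined[OF *(3) that(1) *(1) that(2) *(2), symmetric])
  qed
  show ?thesis
  proof
    show "linear_map R C A G"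
    proof (rule linear_mapI)
      fix x assume "x \<in> carrier C"
      from decomp[OF this] obtain v s where "v \<in> carrier ?P0" "s \<in> S" "x = \<Psi> v \<oplus>\<^bsub>C\<^esub> s" by blast
      then show "G x \<in> carrier A" using G linear_mapD(1)[OF \<psi>] g_closed by simp
    next
      fix x y assume x: "x \<in> carrier C" and y: "y \<in> carrier C"
      from decomp[OF x] obtain v s where v: "v \<in> carrier ?P0" "s \<in> S" "x = \<Psi> v \<oplus>\<^bsub>C\<^esub> s" by blast
      from decomp[OF y] obtain w t where w: "w \<in> carrier ?P0" "t \<in> S" "y = \<Psi> w \<oplus>\<^bsub>C\<^esub> t" by blast
      have st: "s \<in> carrier C" "t \<in> carrier C" using v w SC by auto
      have "x \<oplus>\<^bsub>C\<^esub> y = \<Psi> (v \<oplus>\<^bsub>?P0\<^esub> w) \<oplus>\<^bsub>C\<^esub> (s \<oplus>\<^bsub>C\<^esub> t)"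
        unfolding v(3) w(3) linear_mapD(2)[OF \<Psi> v(1) w(1)]
        using st linear_mapD(1)[OF \<Psi>] v(1) w(1) by (simp add: C.M.a_ac)
      then have "G (x \<oplus>\<^bsub>C\<^esub> y) = \<psi> (v \<oplus>\<^bsub>?P0\<^esub> w) \<oplus>\<^bsub>A\<^esub> g (s \<oplus>\<^bsub>C\<^esub> t)"
        using G[OF P0.M.a_closed[OF v(1) w(1)] S_closed(1)[OF v(2) w(2)]] by simp
      then show "G (x \<oplus>\<^bsub>C\<^esub> y) = G x \<oplus>\<^bsub>A\<^esub> G y"
        unfolding linear_mapD(2)[OF \<psi> v(1) w(1)] g_add[OF v(2) w(2)]
        using G[OF v(1,2)] G[OF w(1,2)] v w linear_mapD(1)[OF \<psi>] g_closed by (simp add: A.M.a_ac)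
    next
      fix r x assume r: "r \<in> carrier R" and x: "x \<in> carrier C"
      from decomp[OF x] obtain v s where v: "v \<in> carrier ?P0" "s \<in> S" "x = \<Psi> v \<oplus>\<^bsub>C\<^esub> s" by blast
      have "r \<odot>\<^bsub>C\<^esub> x = \<Psi> (r \<odot>\<^bsub>?P0\<^esub> v) \<oplus>\<^bsub>C\<^esub> r \<odot>\<^bsub>C\<^esub> s"
        unfolding v(3) linear_mapD(3)[OF \<Psi> r v(1)]
        using r linear_mapD(1)[OF \<Psi> v(1)] v(2) SC by (intro C.smult_r_distr) auto
      then have "G (r \<odot>\<^bsub>C\<^esub> x) = \<psi> (r \<odot>\<^bsub>?P0\<^esub> v) \<oplus>\<^bsub>A\<^esub> g (r \<odot>\<^bsub>C\<^esub> s)"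
        using G[OF P0.smult_closed[OF r v(1)] C.submoduleE(4)[OF S r v(2)]] by simp
      then show "G (r \<odot>\<^bsub>C\<^esub> x) = r \<odot>\<^bsub>A\<^esub> G x"
        unfolding linear_mapD(3)[OF \<psi> r v(1)] g_smult[OF r v(2)]
        using G[OF v(1,2)] v r linear_mapD(1)[OF \<psi>] g_closed by (simp add: A.smult_r_distr)
    qed
    fix x assume x: "x \<in> S"
    \<comment> \<open>An element of \<open>S\<close> has the decomposition with zero vector
      part.\<close>
    have "\<Psi> \<zero>\<^bsub>?P0\<^esub> \<oplus>\<^bsub>C\<^esub> x = x" using linear_map_zero[OF P0 C \<Psi>] x SC by auto
    then show "G x = g x"
      using G[OF P0.M.zero_closed x] linear_map_zero[OF P0 A \<psi>] g_closed[OF x] by simp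
  qed
qed

section \<open>Inverting 1 - u by a locally finite geometric series\<close>

context ring
begin

lemma geometric_sum_closed: "u \<in> carrier R \<Longrightarrow> (\<Oplus>i\<in>{..<n::nat}. u [^] i) \<in> carrier R"
  by (intro finsum_closed) auto

lemma geometric_sum_Suc:
  "u \<in> carrier R \<Longrightarrow> (\<Oplus>i\<in>{..<Suc n}. u [^] i) = u [^] n \<oplus> (\<Oplus>i\<in>{..<n}. u [^] i)"
  unfolding lessThan_Suc by (intro finsum_insert) auto

text \<open>The power stands on the left so that, at an element of \<open>C\<close> where u^n
  vanishes, the equation directly says that the product is the unit there. The step rests on (1 - u)
  u^n + u^(n+1) = u^n and on its mirror image; both orders are needed because the ring is not
  commutative in general.\<close>

lemma geometric_sum:
  assumes u: "u \<in> carrier R"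
  shows "(\<one> \<ominus> u) \<otimes> (\<Oplus>i\<in>{..<n::nat}. u [^] i) \<oplus> u [^] n = \<one>" (is "?P n")
    and "(\<Oplus>i\<in>{..<n::nat}. u [^] i) \<otimes> (\<one> \<ominus> u) \<oplus> u [^] n = \<one>" (is "?Q n")
proof -
  \<comment> \<open>Powers grow by multiplication on the right, whereas the identity with 1 - u on
    the left produces \<open>u\<close> times u^n.\<close>
  have pow: "u [^] n \<in> carrier R" "u \<otimes> u [^] n = u [^] Suc n" for n :: nat
    using u nat_pow_Suc2 by auto
  note cl = u pow(1) geometric_sum_closed[OF u] minus_closed m_closed a_closed a_inv_closed one_closed
  show "?P n"
  proof (induction n)
    case (Suc n)
    let ?S = "\<Oplus>i\<in>{..<n}. u [^] i"
    have "(\<one> \<ominus> u) \<otimes> (u [^] n \<oplus> ?S) \<oplus> u [^] Suc n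
        = (\<one> \<ominus> u) \<otimes> ?S \<oplus> ((\<one> \<ominus> u) \<otimes> u [^] n \<oplus> u [^] Suc n)"
      using cl by (simp add: r_distr a_ac)
    also have "(\<one> \<ominus> u) \<otimes> u [^] n \<oplus> u [^] Suc n = u [^] n"
      using cl pow(2) by (simp add: minus_eq l_distr l_minus a_assoc l_neg)
    finally show ?case using Suc geometric_sum_Suc[OF u] by simp
  qed (use u in simp)
  show "?Q n"
  proof (induction n)
    case (Suc n)
    let ?S = "\<Oplus>i\<in>{..<n}. u [^] i"
    have "(u [^] n \<oplus> ?S) \<otimes> (\<one> \<ominus> u) \<oplus> u [^] Suc n
        = ?S \<otimes> (\<one> \<ominus> u) \<oplus> (u [^] n \<otimes> (\<one> \<ominus> u) \<oplus> u [^] Suc n)"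
      using cl by (simp add: l_distr a_ac)
    also have "u [^] n \<otimes> (\<one> \<ominus> u) \<oplus> u [^] Suc n = u [^] n"
      using cl by (simp add: minus_eq r_distr r_minus a_assoc l_neg)
    finally show ?case using Suc geometric_sum_Suc[OF u] by simp
  qed (use u in simp)
qed

end

section \<open>Vanishing along the filtration and the inverse of 1 - u\<close>

context
  fixes R :: "('r, 'k) ring_scheme"
    and C :: "('r, 'c, 'i) module_scheme"
    and A :: "('r, 'a, 'j) module_scheme"
    and \<Delta> :: "'c \<Rightarrow> ('c \<times> 'c \<Rightarrow> 'r) set"
    and \<epsilon> :: "'c \<Rightarrow> 'r"
    and F :: "nat \<Rightarrow> 'c set"
  assumes C: "coalgebra R C \<Delta> \<epsilon>" and A: "assoc_algebra R A" and F: "QT_sequence R C \<Delta> F"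
begin

interpretation C: coalgebra R C \<Delta> \<epsilon> by (rule C)
interpretation A: assoc_algebra R A by (rule A)
interpretation H: ring "conv_ring R C \<Delta> \<epsilon> A" by (rule conv_ring_ring[OF C A])

abbreviation (input) "\<H> \<equiv> conv_ring R C \<Delta> \<epsilon> A"

lemma QT_sequenceD:
  shows "submodule (F p) R C" and "F p \<subseteq> carrier C" and "p \<le> q \<Longrightarrow> F p \<subseteq> F q"
    and "subcoalgebra R C \<Delta> (F 0)" and "(\<Union>p. F p) = carrier C"
    and "x \<in> F (Suc p) \<Longrightarrow> \<Delta> x \<in> boxtimes R C (F p) (carrier C)
      <+>\<^bsub>tensor_module R C C\<^esub> boxtimes R C (carrier C) (F p)"
proof -
  have *: "submodule (F p) R C" "F p \<subseteq> F (Suc p)" "subcoalgebra R C \<Delta> (F 0)" "(\<Union>p. F p) = carrier C"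
    "\<And>p. p \<ge> 1 \<Longrightarrow> \<Delta> ` F p \<subseteq> boxtimes R C (F (p - 1)) (carrier C)
      <+>\<^bsub>tensor_module R C C\<^esub> boxtimes R C (carrier C) (F (p - 1))" for p
    using F by (auto simp: QT_sequence_def QT_filtration_def)
  show "submodule (F p) R C" "F p \<subseteq> carrier C" "subcoalgebra R C \<Delta> (F 0)" "(\<Union>p. F p) = carrier C"
    using * by blast+
  show "p \<le> q \<Longrightarrow> F p \<subseteq> F q" by (rule lift_Suc_mono_le) (rule *(2))
  show "x \<in> F (Suc p) \<Longrightarrow> \<Delta> x \<in> boxtimes R C (F p) (carrier C)
      <+>\<^bsub>tensor_module R C C\<^esub> boxtimes R C (carrier C) (F p)"
    using *(5)[of "Suc p"] by auto
qed

text \<open>On F_0 both tensor factors of \<open>\<Delta> x\<close> can be taken in F_0, so it is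
  enough that the right map vanish there.\<close>

lemma conv_vanishes_F_0:
  assumes f: "f \<in> mod_hom R C A" and g: "g \<in> mod_hom R C A"
    and "\<And>x. x \<in> F 0 \<Longrightarrow> g x = \<zero>\<^bsub>A\<^esub>" "x \<in> F 0"
  shows "conv R C \<Delta> A (carrier C) f g x = \<zero>\<^bsub>A\<^esub>"
proof -
  obtain xs where xs: "set xs \<subseteq> F 0 \<times> F 0" "\<Delta> x = pair_sum (tensor_module R C C) (tensor R C C) xs"
    using QT_sequenceD(4) assms(4) by (auto simp: subcoalgebra_def boxtimes_def)
  have x: "x \<in> carrier C" and xs': "set xs \<subseteq> carrier C \<times> carrier C"
    using assms(4) xs(1) QT_sequenceD(2) by blast+
  show ?thesis
    unfolding conv_eq_pair_sum[OF C A mod_hom_linear[OF f] mod_hom_linear[OF g] x xs' xs(2)]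
  proof (rule pair_sum_eq_zero[OF A.module_axioms])
    fix y z assume "(y, z) \<in> set xs"
    then have "y \<in> carrier C" "z \<in> F 0" using xs(1) xs' by auto
    then show "f y \<otimes>\<^bsub>A\<^esub> g z = \<zero>\<^bsub>A\<^esub>" using assms(3) mod_hom_closed[OF f] by simp
  qed
qed

text \<open>Each term of \<open>\<Delta> x\<close> has one entry in \<open>F p\<close>, but this may
  be the left or the right one, so both maps have to vanish on \<open>F p\<close>.\<close>

lemma conv_vanishes_F_Suc:
  assumes f: "f \<in> mod_hom R C A" and g: "g \<in> mod_hom R C A"
    and f0: "\<And>x. x \<in> F p \<Longrightarrow> f x = \<zero>\<^bsub>A\<^esub>" and g0: "\<And>x. x \<in> F p \<Longrightarrow> g x = \<zero>\<^bsub>A\<^esub>" and x: "x \<in> F (Suc p)"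
  shows "conv R C \<Delta> A (carrier C) f g x = \<zero>\<^bsub>A\<^esub>"
proof -
  let ?T = "tensor_module R C C"
  note mods = C.module_axioms A.module_axioms
  note Fp = QT_sequenceD(2)[of p]
  obtain xs ys where xs: "set xs \<subseteq> F p \<times> carrier C" and ys: "set ys \<subseteq> carrier C \<times> F p"
    and \<Delta>: "\<Delta> x = pair_sum ?T (tensor R C C) xs \<oplus>\<^bsub>?T\<^esub> pair_sum ?T (tensor R C C) ys"
    using QT_sequenceD(6)[OF x] by (auto simp: boxtimes_def set_add_def')
  have cl: "set (xs @ ys) \<subseteq> carrier C \<times> carrier C"
    using xs ys Fp by auto
  have "\<Delta> x = pair_sum ?T (tensor R C C) (xs @ ys)"
    unfolding \<Delta> using cl
    by (intro pair_sum_append[OF tensor_module_module[OF mods(1,1)], symmetric] tensor_closed[OF mods(1,1)]) auto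
  moreover have "x \<in> carrier C" using x QT_sequenceD(2) by blast
  ultimately have "conv R C \<Delta> A (carrier C) f g x = pair_sum A (\<lambda>x y. f x \<otimes>\<^bsub>A\<^esub> g y) (xs @ ys)"
    using conv_eq_pair_sum[OF C A mod_hom_linear[OF f] mod_hom_linear[OF g] _ cl] by blast
  also have "\<dots> = \<zero>\<^bsub>A\<^esub>"
  proof (rule pair_sum_eq_zero[OF A.module_axioms])
    fix y z assume "(y, z) \<in> set (xs @ ys)"
    then have "y \<in> carrier C" "z \<in> carrier C" "y \<in> F p \<or> z \<in> F p" using xs ys cl by auto
    then show "f y \<otimes>\<^bsub>A\<^esub> g z = \<zero>\<^bsub>A\<^esub>"
      using f0 g0 mod_hom_closed[OF f] mod_hom_closed[OF g] by auto
  qed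
  finally show ?thesis .
qed

text \<open>Exhaustiveness puts each element in some stage, and monotonicity puts finitely many in
  the largest of these.\<close>

lemma finite_subset_F:
  assumes "finite X" "X \<subseteq> carrier C"
  obtains p where "X \<subseteq> F p"
proof -
  have "\<exists>p. X \<subseteq> F p"
    using assms
  proof (induction X rule: finite_induct)
    case (insert x X)
    then have "x \<in> (\<Union>p. F p)" unfolding QT_sequenceD(5) by simp
    then obtain q where "x \<in> F q" by blast
    moreover from insert obtain p where "X \<subseteq> F p" by auto
    ultimately have "insert x X \<subseteq> F (max p q)"
      using QT_sequenceD(3)[of p "max p q"] QT_sequenceD(3)[of q "max p q"] by auto
    then show ?case by blast
  qed simp
  then show ?thesis using that by blast
qed

context
  fixes u :: "'c \<Rightarrow> 'a"
  assumes u: "u \<in> mod_hom R C A" and u0: "\<And>x. x \<in> F 0 \<Longrightarrow> u x = \<zero>\<^bsub>A\<^esub>"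
begin

lemma conv_pow_mod_hom: "u [^]\<^bsub>\<H>\<^esub> (m::nat) \<in> mod_hom R C A"
  using H.nat_pow_closed u by simp

text \<open>
  The condition on \<open>\<Delta>(F\<^sub>p)\<close> only kills a product both of whose factors vanish on \<open>F\<^sub>p\<^sub>-\<^sub>1\<close>, so the
  exponent has to double at each step.
\<close>

lemma conv_pow_vanishes:
  "\<lbrakk>2 ^ p \<le> m; x \<in> F p\<rbrakk> \<Longrightarrow> (u [^]\<^bsub>\<H>\<^esub> (m::nat)) x = \<zero>\<^bsub>A\<^esub>"
proof (induction p arbitrary: m x)
  case 0
  \<comment> \<open>Since 2^0 = 1, there is a last factor \<open>u\<close>, on the right as
    \<open>conv_vanishes_F_0\<close> requires.\<close>
  then obtain k where "m = Suc k" using not0_implies_Suc by fastforce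
  then show ?case using conv_vanishes_F_0[OF conv_pow_mod_hom u u0 0(2)] by simp
next
  case (Suc p)
  \<comment> \<open>Both \<open>k\<close> and \<open>2 ^ p\<close> are at least
    \<open>2 ^ p\<close>. As \<open>k\<close> may be strictly larger, the induction has to cover all
    exponents from the bound on.\<close>
  define k :: nat where "k = m - 2 ^ p"
  have k: "m = k + 2 ^ p" "2 ^ p \<le> k" using Suc.prems(1) by (auto simp: k_def)
  have "u [^]\<^bsub>\<H>\<^esub> m = conv R C \<Delta> A (carrier C) (u [^]\<^bsub>\<H>\<^esub> k) (u [^]\<^bsub>\<H>\<^esub> (2 ^ p :: nat))"
    using H.nat_pow_mult[of u k "2 ^ p"] u k(1) by simp
  then show ?case
    using conv_vanishes_F_Suc[OF conv_pow_mod_hom conv_pow_mod_hom Suc.IH Suc.IH Suc.prems(2), of k "2 ^ p"]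
      k(2) by simp
qed

abbreviation (input) "geo n \<equiv> (\<Oplus>\<^bsub>\<H>\<^esub>i\<in>{..<n::nat}. u [^]\<^bsub>\<H>\<^esub> i)"

lemma geo_mod_hom: "geo n \<in> mod_hom R C A"
  using H.geometric_sum_closed u by simp

text \<open>Consecutive partial sums differ by u^n, which vanishes on \<open>F p\<close> once n
  reaches \<open>2 ^ p\<close>.\<close>

lemma geo_stable:
  assumes "2 ^ p \<le> n" "x \<in> F p"
  shows "geo n x = geo (2 ^ p) x"
  using assms(1)
proof (induction n rule: dec_induct)
  case (step n)
  have x: "x \<in> carrier C" using assms(2) QT_sequenceD(2) by blast
  have "geo (Suc n) x = (u [^]\<^bsub>\<H>\<^esub> n) x \<oplus>\<^bsub>A\<^esub> geo n x"
    using H.geometric_sum_Suc[of u n] u x by simp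
  then show ?case
    using step conv_pow_vanishes[OF step(1) assms(2)] mod_hom_closed[OF geo_mod_hom x] by simp
qed simp

text \<open>The series is cut off separately at each element. The least stage containing it fixes a
  definite length, and every longer partial sum has the same value there.\<close>

definition geo_limit :: "'c \<Rightarrow> 'a"
  where "geo_limit = (\<lambda>x\<in>carrier C. geo (2 ^ (LEAST p. x \<in> F p)) x)"

lemma geo_limit_eq:
  assumes "x \<in> F p" "2 ^ p \<le> n"
  shows "geo_limit x = geo n x"
proof -
  let ?q = "LEAST p. x \<in> F p"
  have "x \<in> F ?q" "?q \<le> p" using assms(1) by (rule LeastI, rule Least_le)
  moreover from this(2) have "2 ^ ?q \<le> n" using assms(2) power_increasing[of ?q p "2::nat"] by linarith
  moreover have "x \<in> carrier C" using assms(1) QT_sequenceD(2) by blast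
  ultimately show ?thesis using geo_stable unfolding geo_limit_def by simp
qed

text \<open>This replaces the limit by one partial sum: linearity tests two or three elements, and a
  convolution at \<open>x\<close> only the entries of one expression of
  \<open>\<Delta> x\<close>.\<close>

lemma geo_limit_eq_on_finite:
  assumes "finite X" "X \<subseteq> carrier C"
  shows "\<exists>n. (\<forall>x\<in>X. geo_limit x = geo n x) \<and> (\<forall>x\<in>X. (u [^]\<^bsub>\<H>\<^esub> n) x = \<zero>\<^bsub>A\<^esub>)"
proof -
  obtain p where "X \<subseteq> F p" using assms by (rule finite_subset_F)
  then show ?thesis using geo_limit_eq[of _ p "2 ^ p"] conv_pow_vanishes[of p "2 ^ p"] by blast
qed

lemma geo_limit_mod_hom: "geo_limit \<in> mod_hom R C A"
proof -
  have "linear_map R C A geo_limit"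
  proof (rule linear_mapI)
    fix x assume x: "x \<in> carrier C"
    then obtain n where "geo_limit x = geo n x" using geo_limit_eq_on_finite[of "{x}"] by auto
    then show "geo_limit x \<in> carrier A" using mod_hom_closed[OF geo_mod_hom x] by simp
  next
    fix x y assume *: "x \<in> carrier C" "y \<in> carrier C"
    then obtain n where "geo_limit x = geo n x" "geo_limit y = geo n y"
        "geo_limit (x \<oplus>\<^bsub>C\<^esub> y) = geo n (x \<oplus>\<^bsub>C\<^esub> y)"
      using geo_limit_eq_on_finite[of "{x, y, x \<oplus>\<^bsub>C\<^esub> y}"] by auto
    then show "geo_limit (x \<oplus>\<^bsub>C\<^esub> y) = geo_limit x \<oplus>\<^bsub>A\<^esub> geo_limit y"
      using * linear_mapD(2)[OF mod_hom_linear[OF geo_mod_hom]] by simp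
  next
    fix r x assume *: "r \<in> carrier R" "x \<in> carrier C"
    then obtain n where "geo_limit x = geo n x" "geo_limit (r \<odot>\<^bsub>C\<^esub> x) = geo n (r \<odot>\<^bsub>C\<^esub> x)"
      using geo_limit_eq_on_finite[of "{x, r \<odot>\<^bsub>C\<^esub> x}"] by auto
    then show "geo_limit (r \<odot>\<^bsub>C\<^esub> x) = r \<odot>\<^bsub>A\<^esub> geo_limit x"
      using * linear_mapD(3)[OF mod_hom_linear[OF geo_mod_hom]] by simp
  qed
  then show ?thesis by (simp add: mod_hom_iff geo_limit_def)
qed

lemma one_minus_Units: "\<one>\<^bsub>\<H>\<^esub> \<ominus>\<^bsub>\<H>\<^esub> u \<in> Units \<H>"
proof -
  let ?a = "\<one>\<^bsub>\<H>\<^esub> \<ominus>\<^bsub>\<H>\<^esub> u"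
  have uH: "u \<in> carrier \<H>" using u by simp
  have aH: "?a \<in> carrier \<H>" using uH by (intro H.minus_closed H.one_closed)
  then have a: "?a \<in> mod_hom R C A" by (simp only: conv_ring_sel)
  have wH: "geo_limit \<in> carrier \<H>" using geo_limit_mod_hom by simp
  note lin = mod_hom_linear[OF a] mod_hom_linear[OF geo_limit_mod_hom] mod_hom_linear[OF geo_mod_hom]
  have "(?a \<otimes>\<^bsub>\<H>\<^esub> geo_limit) x = \<one>\<^bsub>\<H>\<^esub> x \<and> (geo_limit \<otimes>\<^bsub>\<H>\<^esub> ?a) x = \<one>\<^bsub>\<H>\<^esub> x" if x: "x \<in> carrier C" for x
  proof -
    obtain xs where xs: "set xs \<subseteq> carrier C \<times> carrier C"
        "\<Delta> x = pair_sum (tensor_module R C C) (tensor R C C) xs"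
      using comultE[OF C A x] by blast
    \<comment> \<open>On the entries of \<open>xs\<close> the limit has to agree with the partial
      sum; at \<open>x\<close> itself the remainder u^n has to vanish.\<close>
    let ?X = "insert x (fst ` set xs \<union> snd ` set xs)"
    have "finite ?X" "?X \<subseteq> carrier C" using xs(1) x by auto
    then obtain n where n: "\<And>y. y \<in> ?X \<Longrightarrow> geo_limit y = geo n y"
        "\<And>y. y \<in> ?X \<Longrightarrow> (u [^]\<^bsub>\<H>\<^esub> n) y = \<zero>\<^bsub>A\<^esub>"
      using geo_limit_eq_on_finite[of ?X] by blast
    have n': "geo_limit y = geo n y" "geo_limit z = geo n z" if "(y, z) \<in> set xs" for y z
      by (rule n(1), use that in force)+
    have one: "h x = \<one>\<^bsub>\<H>\<^esub> x" if "h \<oplus>\<^bsub>\<H>\<^esub> u [^]\<^bsub>\<H>\<^esub> n = \<one>\<^bsub>\<H>\<^esub>" "h \<in> mod_hom R C A" for h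
    proof -
      have "h x \<oplus>\<^bsub>A\<^esub> (u [^]\<^bsub>\<H>\<^esub> n) x = \<one>\<^bsub>\<H>\<^esub> x" using fun_cong[OF that(1), of x] x by simp
      then show ?thesis using n(2)[of x] mod_hom_closed[OF that(2) x] by simp
    qed
    have "(?a \<otimes>\<^bsub>\<H>\<^esub> geo_limit) x = (?a \<otimes>\<^bsub>\<H>\<^esub> geo n) x"
      unfolding conv_ring_sel(2) conv_eq_pair_sum[OF C A lin(1,2) x xs] conv_eq_pair_sum[OF C A lin(1,3) x xs]
      by (rule pair_sum_cong) (simp only: n')
    also have "\<dots> = \<one>\<^bsub>\<H>\<^esub> x"
      using conv_mod_hom[OF C A a geo_mod_hom]
      by (intro one[OF H.geometric_sum(1)[OF uH]]) (simp only: conv_ring_sel(2))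
    finally have left: "(?a \<otimes>\<^bsub>\<H>\<^esub> geo_limit) x = \<one>\<^bsub>\<H>\<^esub> x" .
    have "(geo_limit \<otimes>\<^bsub>\<H>\<^esub> ?a) x = (geo n \<otimes>\<^bsub>\<H>\<^esub> ?a) x"
      unfolding conv_ring_sel(2) conv_eq_pair_sum[OF C A lin(2,1) x xs] conv_eq_pair_sum[OF C A lin(3,1) x xs]
      by (rule pair_sum_cong) (simp only: n')
    also have "\<dots> = \<one>\<^bsub>\<H>\<^esub> x"
      using conv_mod_hom[OF C A geo_mod_hom a]
      by (intro one[OF H.geometric_sum(2)[OF uH]]) (simp only: conv_ring_sel(2))
    finally show ?thesis using left by simp
  qed
  moreover have "?a \<otimes>\<^bsub>\<H>\<^esub> geo_limit \<in> mod_hom R C A" "geo_limit \<otimes>\<^bsub>\<H>\<^esub> ?a \<in> mod_hom R C A"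
      "\<one>\<^bsub>\<H>\<^esub> \<in> mod_hom R C A"
    using H.m_closed[OF aH wH] H.m_closed[OF wH aH] H.one_closed by (simp_all only: conv_ring_sel(1))
  ultimately have "?a \<otimes>\<^bsub>\<H>\<^esub> geo_limit = \<one>\<^bsub>\<H>\<^esub>" "geo_limit \<otimes>\<^bsub>\<H>\<^esub> ?a = \<one>\<^bsub>\<H>\<^esub>"
    by (blast intro: mod_hom_eqI)+
  then show ?thesis using aH wH by (auto simp: Units_def simp del: conv_ring_sel)
qed

end

text \<open>Take u = 1 - a, which vanishes on F_0; then a = 1 - u.\<close>

lemma Units_if_one_on_F_0:
  assumes a: "a \<in> mod_hom R C A" and "\<And>x. x \<in> F 0 \<Longrightarrow> a x = unit_map A (\<epsilon> x)"
  shows "a \<in> Units \<H>"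
proof -
  have aH: "a \<in> carrier \<H>" using a by simp
  let ?u = "\<one>\<^bsub>\<H>\<^esub> \<ominus>\<^bsub>\<H>\<^esub> a"
  have uH: "?u \<in> carrier \<H>" using aH by (intro H.minus_closed H.one_closed)
  then have u: "?u \<in> mod_hom R C A" by (simp only: conv_ring_sel)
  have "?u x = \<zero>\<^bsub>A\<^esub>" if x: "x \<in> F 0" for x
  proof -
    have xC: "x \<in> carrier C" using x QT_sequenceD(2) by blast
    \<comment> \<open>Negation in the ring is not given by a pointwise formula, so the equation u +
      a = 1 is evaluated at \<open>x\<close> and the value of \<open>a\<close> is cancelled.\<close>
    have "?u \<oplus>\<^bsub>\<H>\<^esub> a = \<one>\<^bsub>\<H>\<^esub>"
      using aH H.one_closed by (simp only: H.minus_eq H.a_assoc H.l_neg H.r_zero H.a_inv_closed)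
    then have "(?u \<oplus>\<^bsub>\<H>\<^esub> a) x = a x" using assms(2)[OF x] xC by simp
    then have "?u x \<oplus>\<^bsub>A\<^esub> a x = a x" using xC by simp
    then show ?thesis using mod_hom_closed[OF u xC] mod_hom_closed[OF a xC] by simp
  qed
  from one_minus_Units[OF u this] have "\<one>\<^bsub>\<H>\<^esub> \<ominus>\<^bsub>\<H>\<^esub> ?u \<in> Units \<H>" .
  moreover have "\<one>\<^bsub>\<H>\<^esub> \<ominus>\<^bsub>\<H>\<^esub> ?u = a"
    using aH H.one_closed by (simp only: H.minus_eq H.minus_add H.minus_minus H.a_inv_closed H.r_neg2)
  ultimately show ?thesis by simp
qed

end

section \<open>From units on C to the equivalence with invertibility on F_0\<close>

text \<open>A unit x y gives the right inverse y (x y)^(-1) of x, and a unit y x gives the left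
  inverse (y x)^(-1) y. A left and a right inverse coincide.\<close>

lemma (in monoid) Units_if_products_Units:
  assumes "x \<in> carrier G" "y \<in> carrier G" "x \<otimes> y \<in> Units G" "y \<otimes> x \<in> Units G"
  shows "x \<in> Units G"
proof -
  let ?r = "y \<otimes> inv (x \<otimes> y)" and ?l = "inv (y \<otimes> x) \<otimes> y"
  have cl: "?r \<in> carrier G" "?l \<in> carrier G" using assms by auto
  have "x \<otimes> ?r = \<one>" using assms Units_r_inv[OF assms(3)] by (simp flip: m_assoc)
  moreover have "?l \<otimes> x = \<one>" using assms Units_l_inv[OF assms(4)] by (simp add: m_assoc)
  moreover from calculation have "?l = ?r" using inv_unique assms(1) cl by blast
  ultimately show ?thesis using assms(1) cl by (auto simp: Units_def)
qed

lemma restrict_submodule_mod_hom: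
  assumes "module R C" "submodule S R C" "linear_map R C A g"
  shows "restrict g S \<in> mod_hom R (C\<lparr>carrier := S\<rparr>) A"
proof -
  interpret module R C by fact
  have "linear_map R (C\<lparr>carrier := S\<rparr>) A g"
    using submoduleE(1)[OF assms(2)] linear_mapD[OF assms(3)] by (intro linear_mapI) (simp_all add: subset_iff)
  from restrict_mod_hom[OF submodule.submodule_is_module[OF assms(2,1)] this] show ?thesis by simp
qed

theorem theorem3p3:
  fixes R :: "('r, 'k) ring_scheme"
    and C :: "('r, 'c, 'i) module_scheme"
    and A :: "('r, 'a, 'j) module_scheme"
    and \<Delta> :: "'c \<Rightarrow> ('c \<times> 'c \<Rightarrow> 'r) set"
    and \<epsilon> :: "'c \<Rightarrow> 'r"
    and F :: "nat \<Rightarrow> 'c set"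
    and f :: "'c \<Rightarrow> 'a"
  assumes "cring R"
    and "coalgebra R C \<Delta> \<epsilon>"
    and "assoc_algebra R A"
    and "QT_sequence R C \<Delta> F"
    and "carrier (Ext1 R (quot_module C (F 0)) A) = {\<zero>\<^bsub>Ext1 R (quot_module C (F 0)) A\<^esub>}"
    and "f \<in> mod_hom R C A"
  shows "f \<in> Units (conv_algebra R C \<Delta> \<epsilon> A (carrier C)) \<longleftrightarrow>
         restrict f (F 0) \<in> Units (conv_algebra R C \<Delta> \<epsilon> A (F 0))"
proof -
  interpret C: coalgebra R C \<Delta> \<epsilon> by fact
  interpret A: assoc_algebra R A by fact
  let ?H = "conv_ring R C \<Delta> \<epsilon> A" and ?S = "conv_algebra R C \<Delta> \<epsilon> A (F 0)"
  interpret H: ring ?H by (rule conv_ring_ring[OF assms(2,3)])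
  note F = QT_sequenceD[OF assms(2-4)]
  note restrict = restrict_submodule_mod_hom[OF C.module_axioms F(1)[of 0]]
  have one_S: "\<one>\<^bsub>?S\<^esub> = restrict \<one>\<^bsub>?H\<^esub> (F 0)"
    using F(2)[of 0] by (auto simp: conv_algebra_def fun_eq_iff)
  have mult_S: "restrict g (F 0) \<otimes>\<^bsub>?S\<^esub> restrict h (F 0) = restrict (g \<otimes>\<^bsub>?H\<^esub> h) (F 0)"
    if "g \<in> mod_hom R C A" "h \<in> mod_hom R C A" for g h
    using conv_subcoalgebra[OF assms(2,3) mod_hom_linear[OF that(1)] mod_hom_linear[OF that(2)] F(4)]
    by (simp add: conv_algebra_def)
  show ?thesis
    unfolding Units_conv_ring
  proof
    \<comment> \<open>Restriction to F_0 respects products and the unit, so it carries an inverse to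
      an inverse.\<close>
    assume "f \<in> Units ?H"
    then obtain g where g: "g \<in> mod_hom R C A" "f \<otimes>\<^bsub>?H\<^esub> g = \<one>\<^bsub>?H\<^esub>" "g \<otimes>\<^bsub>?H\<^esub> f = \<one>\<^bsub>?H\<^esub>"
      unfolding Units_def conv_ring_sel(1) by blast
    have "restrict f (F 0) \<in> carrier ?S" "restrict g (F 0) \<in> carrier ?S"
      using restrict[OF mod_hom_linear[OF assms(6)]] restrict[OF mod_hom_linear[OF g(1)]] by (simp_all add: conv_algebra_def)
    moreover have "restrict f (F 0) \<otimes>\<^bsub>?S\<^esub> restrict g (F 0) = \<one>\<^bsub>?S\<^esub>"
        "restrict g (F 0) \<otimes>\<^bsub>?S\<^esub> restrict f (F 0) = \<one>\<^bsub>?S\<^esub>"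
      unfolding one_S mult_S[OF assms(6) g(1)] mult_S[OF g(1) assms(6)] g(2,3) by simp_all
    ultimately show "restrict f (F 0) \<in> Units ?S" unfolding Units_def by blast
  next
    assume "restrict f (F 0) \<in> Units ?S"
    then obtain g0 where g0: "g0 \<in> carrier ?S" "restrict f (F 0) \<otimes>\<^bsub>?S\<^esub> g0 = \<one>\<^bsub>?S\<^esub>"
        "g0 \<otimes>\<^bsub>?S\<^esub> restrict f (F 0) = \<one>\<^bsub>?S\<^esub>"
      unfolding Units_def by blast
    have g0_hom: "linear_map R (C\<lparr>carrier := F 0\<rparr>) A g0" "g0 \<in> extensional (F 0)"
      using g0(1) by (simp_all add: conv_algebra_def mod_hom_iff)
    obtain G where G: "linear_map R C A G" "\<And>x. x \<in> F 0 \<Longrightarrow> G x = g0 x"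
      using ext1_extension[OF C.module_axioms A.module_axioms F(1) assms(5) g0_hom(1)] by blast
    define g where "g = restrict G (carrier C)"
    have g: "g \<in> mod_hom R C A" unfolding g_def by (rule restrict_mod_hom[OF C.module_axioms G(1)])
    \<comment> \<open>Extensionality makes \<open>g0\<close> literally a restriction, the form in
      which \<open>mult_S\<close> can compare its products with those in Hom(C, A).\<close>
    have "g0 = restrict g (F 0)"
      using G(2) g0_hom(2) F(2)[of 0] by (auto simp: g_def fun_eq_iff extensional_def)
    with g0(2,3) have eq: "restrict (f \<otimes>\<^bsub>?H\<^esub> g) (F 0) = restrict \<one>\<^bsub>?H\<^esub> (F 0)"
        "restrict (g \<otimes>\<^bsub>?H\<^esub> f) (F 0) = restrict \<one>\<^bsub>?H\<^esub> (F 0)"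
      by (simp_all only: one_S mult_S[OF assms(6) g] mult_S[OF g assms(6)])
    have unit: "h \<in> Units ?H" if "h \<in> mod_hom R C A" "restrict h (F 0) = restrict \<one>\<^bsub>?H\<^esub> (F 0)" for h
    proof (rule Units_if_one_on_F_0[OF assms(2-4) that(1)])
      fix x assume x: "x \<in> F 0"
      then show "h x = unit_map A (\<epsilon> x)" using fun_cong[OF that(2), of x] F(2)[of 0] by auto
    qed
    have fg: "f \<otimes>\<^bsub>?H\<^esub> g \<in> mod_hom R C A" and gf: "g \<otimes>\<^bsub>?H\<^esub> f \<in> mod_hom R C A"
      using conv_mod_hom[OF assms(2,3)] assms(6) g by simp_all
    have "f \<in> carrier ?H" "g \<in> carrier ?H" using assms(6) g by simp_all
    then show "f \<in> Units ?H"
      by (rule H.Units_if_products_Units[OF _ _ unit[OF fg eq(1)] unit[OF gf eq(2)]])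
  qed
qed

end
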